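(* Let $(Y^7,\varphi)$ be a torsion-free $G_2$ manifold. With the maps $b^k:E^k\to G_1^{k+1}$, $c^k:G_0^k\to G_1^{k+1}$ and $\mathcal K^k:G_0^k\to E^k$ (as defined in the context), the residual coupling vanishes: $$c^k+b^k\mathcal K^k=0$$ in every canonical degree $k$. In fact $\mathfrak c+\mathfrak b\mathcal K=0$ before projection on arbitrary exterior forms, i.e. $\mathfrak c m+\mathfrak b(\mathcal Km)=0$ for every $p$ and every $m\in\Omega^p(Y,T^*Y)$.
   Context: Geometry. $Y$ is a smooth seven-manifold with a positive three-form $\varphi$ (a $G_2$ structure), with associated metric $g$ and orientation, normalized so that locally there is an oriented $g$-orthonormal coframe with $\varphi=e^{123}+e^{145}+e^{167}+e^{246}-e^{257}-e^{347}-e^{356}$; $\psi=*\varphi$. Torsion-free means $\mathrm d\varphi=0$ and $\mathrm d\psi=0$; equivalently the Levi-Civita connection $\nabla$ preserves $\varphi$ and $\psi$. No compactness is assumed. $R(X,Y)=[\nabla_X,\nabla_Y]-\nabla_{[X,Y]}$ is the Riemann curvature, regarded as an $\operatorname{End}(TY)$-valued two-form. Canonical cochains. $\Lambda^2=\Lambda^2_7\oplus\Lambda^2_{14}$ with $\Lambda^2_7=\{\iota_X\varphi\}$, $\Lambda^2_{14}=\{\eta:\eta\wedge\psi=0\}$, and $\Lambda^3_1=\mathbb R\varphi\subset\Lambda^3$. Put $\Lambda^0_{\rm can}=\Lambda^0$, $\Lambda^1_{\rm can}=\Lambda^1$, $\Lambda^2_{\rm can}=\Lambda^2_7$, $\Lambda^3_{\rm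 can}=\Lambda^3_1$, and zero in other degrees; $\Pi_k:\Lambda^k\to\Lambda^k_{\rm can}$ is the orthogonal projection ($\Pi_0,\Pi_1$ identities, $\Pi_4=0$). For a bundle $W$, $\mathcal C^k(W)=\Gamma(\Lambda^k_{\rm can}T^*Y\otimes W)$. $E=\operatorname{End}_0(TY)$ is the trace-free endomorphism bundle, $G_0^\bullet=\mathcal C^\bullet(T^*Y)$, $E^\bullet=\mathcal C^\bullet(E)$, and $G_1^\bullet=\epsilon\,\mathcal C^\bullet(T^*Y)$ where $\epsilon$ is a formal parameter with $\epsilon^2=0$. Operators. For a $T^*Y$-valued form $m$ write $m_X=m(\cdot,X)$ for the evaluation of the $T^*Y$ factor on $X$. $\tau(S,T)=\operatorname{tr}_7(ST)$ is the real matrix trace on $TY$; for matrix-valued forms $\tau(\alpha\wedge\beta)$ is the trace of the wedge–matrix product in the displayed order. $\iota_ZR$ is the $\operatorname{End}(TY)$-valued one-form $X\mapsto R(Z,X)$. For $m\in\Omega^p(Y,T^*Y)$, $\mathcal B(m)\in\Omega^p(Y,\operatorname{End}(TY))$ is defined by $g(X,\mathcal B(m)Y)=(\nabla_Xm)_Y$. On unrestricted forms $(\mathfrak b a)(Z)=-\frac{\epsilon}{4}\tau(\iota_ZR\wedge a)$ for $a\in\Omega^p(Y,E)$ and $(\mathfrak c m)(Z)=-\frac{\epsilon}{2}\tau(\iota_ZR\wedge\mathcal B(m))$ for $m\in\Omega^p(Y,T^*Y)$, where $(\cdot)(Z)$ is evaluation of the $T^*Y$ factor. $b^k=\Pi_{k+1}\mathfrak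 b:E^k\to G_1^{k+1}$ and $c^k=\Pi_{k+1}\mathfrak c:G_0^k\to G_1^{k+1}$ (zero for $k=3$). $\mathcal K:\Omega^p(Y,T^*Y)\to\Omega^p(Y,\mathfrak{so}(TY))\subset\Omega^p(Y,E)$ is $(\mathcal Km)(X,Y)=(\nabla_Ym)_X-(\nabla_Xm)_Y$, where a two-form $A$ is identified with the skew endomorphism $A^\sharp$ by $g(X,A^\sharp Y)=A(X,Y)$; since $\nabla\Pi_k=0$ it restricts to $\mathcal K^k:G_0^k\to E^k$. *)

theory Defs
  imports "HOL-Analysis.Analysis" "HOL-Library.Function_Algebras"
begin

(* Functions, vector fields and forms are added and subtracted pointwise (Function_Algebras);
   the product of two real functions is also pointwise. *)

section \<open>Smooth seven-manifolds\<close>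

(* C^k via iterated directional derivatives; meant for open S only. *)
primrec Ck_on :: "nat \<Rightarrow> 'v::euclidean_space set \<Rightarrow> ('v \<Rightarrow> 'w::real_normed_vector) \<Rightarrow> bool" where
  "Ck_on 0 S f \<longleftrightarrow> continuous_on S f"
| "Ck_on (Suc k) S f \<longleftrightarrow>
     (\<forall>x\<in>S. f differentiable (at x)) \<and> (\<forall>v. Ck_on k S (\<lambda>x. frechet_derivative f (at x) v))"

definition smooth_on :: "'v::euclidean_space set \<Rightarrow> ('v \<Rightarrow> 'w::real_normed_vector) \<Rightarrow> bool" where
  "smooth_on S f \<longleftrightarrow> (\<forall>k. Ck_on k S f)"

type_synonym 'a chart = "'a set \<times> ('a \<Rightarrow> real ^ 7)"

definition is_chart :: "'a::topological_space chart \<Rightarrow> bool" where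
  "is_chart c \<longleftrightarrow> (case c of (U, x) \<Rightarrow>
     open U \<and> open (x ` U) \<and> homeomorphism U (x ` U) x (inv_into U x))"

definition smooth_atlas :: "'a::topological_space chart set \<Rightarrow> bool" where
  "smooth_atlas A \<longleftrightarrow>
     (\<forall>c\<in>A. is_chart c) \<and> (\<Union>(U, x)\<in>A. U) = UNIV \<and>
     (\<forall>(U, x)\<in>A. \<forall>(V, y)\<in>A. smooth_on (x ` (U \<inter> V)) (y \<circ> inv_into U x))"

type_synonym 'a fn = "'a \<Rightarrow> real"

definition smooth_funs :: "'a chart set \<Rightarrow> 'a fn set" where
  "smooth_funs A = {f. \<forall>(U, x)\<in>A. smooth_on (x ` U) (f \<circ> inv_into U x)}"

(* Tangent vectors are point derivations of the algebra of smooth functions.  Everything below is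
   extensional: an operator is 0 on arguments outside its intended domain, so that equality of
   HOL functions is equality of the geometric objects. *)
definition tangent_space :: "'a chart set \<Rightarrow> 'a \<Rightarrow> ('a fn \<Rightarrow> real) set" where
  "tangent_space A p = {v.
     (\<forall>f. f \<notin> smooth_funs A \<longrightarrow> v f = 0) \<and>
     (\<forall>f\<in>smooth_funs A. \<forall>h\<in>smooth_funs A. v (f + h) = v f + v h) \<and>
     (\<forall>f\<in>smooth_funs A. \<forall>r. v (\<lambda>x. r * f x) = r * v f) \<and>
     (\<forall>f\<in>smooth_funs A. \<forall>h\<in>smooth_funs A. v (f * h) = f p * v h + h p * v f)}"

type_synonym 'a vf = "'a fn \<Rightarrow> 'a fn"

(* Smooth sections of TY; X f is the derivative of f along X. *)
definition vector_fields :: "'a chart set \<Rightarrow> 'a vf set" where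
  "vector_fields A = {X. (\<forall>p. (\<lambda>f. X f p) \<in> tangent_space A p) \<and>
     (\<forall>f\<in>smooth_funs A. X f \<in> smooth_funs A)}"

definition bracket :: "'a vf \<Rightarrow> 'a vf \<Rightarrow> 'a vf" where
  "bracket X Y = (\<lambda>f. X (Y f) - Y (X f))"

(* Multiplication by a function, used for vector fields as well as for covector fields. *)
definition act :: "'a fn \<Rightarrow> ('b \<Rightarrow> 'a fn) \<Rightarrow> ('b \<Rightarrow> 'a fn)" where
  "act f F = (\<lambda>y. f * F y)"

section \<open>Tensor fields\<close>

(* Tensor fields are C^infinity(Y)-multilinear maps on vector fields.  The parameter sm is the
   action of functions on the module M of values. *)

definition lin_maps ::
  "'a chart set \<Rightarrow> ('a fn \<Rightarrow> 'b \<Rightarrow> 'b) \<Rightarrow> 'b::{plus,zero} set \<Rightarrow> ('a vf \<Rightarrow> 'b) set" where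
  "lin_maps A sm M = {\<alpha>.
     (\<forall>X. X \<notin> vector_fields A \<longrightarrow> \<alpha> X = 0) \<and>
     (\<forall>X\<in>vector_fields A. \<alpha> X \<in> M) \<and>
     (\<forall>X\<in>vector_fields A. \<forall>Y\<in>vector_fields A. \<alpha> (X + Y) = \<alpha> X + \<alpha> Y) \<and>
     (\<forall>f\<in>smooth_funs A. \<forall>X\<in>vector_fields A. \<alpha> (act f X) = sm f (\<alpha> X))}"

(* Sections of T^*Y and of End(TY). *)
definition covectors :: "'a chart set \<Rightarrow> ('a vf \<Rightarrow> 'a fn) set" where
  "covectors A = lin_maps A (*) (smooth_funs A)"

definition endos :: "'a chart set \<Rightarrow> ('a vf \<Rightarrow> 'a vf) set" where
  "endos A = lin_maps A act (vector_fields A)"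

definition args :: "'a chart set \<Rightarrow> nat \<Rightarrow> 'a vf list set" where
  "args A k = {vs. length vs = k \<and> set vs \<subseteq> vector_fields A}"

definition alt_maps ::
  "'a chart set \<Rightarrow> ('a fn \<Rightarrow> 'b \<Rightarrow> 'b) \<Rightarrow> 'b::{plus,zero} set \<Rightarrow> nat \<Rightarrow> ('a vf list \<Rightarrow> 'b) set" where
  "alt_maps A sm M k = {\<omega>.
     (\<forall>vs. vs \<notin> args A k \<longrightarrow> \<omega> vs = 0) \<and>
     (\<forall>vs\<in>args A k. \<omega> vs \<in> M) \<and>
     (\<forall>vs\<in>args A k. \<forall>i<k. \<forall>X\<in>vector_fields A. \<forall>Y\<in>vector_fields A.
        \<omega> (vs[i := X + Y]) = \<omega> (vs[i := X]) + \<omega> (vs[i := Y])) \<and>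
     (\<forall>vs\<in>args A k. \<forall>i<k. \<forall>f\<in>smooth_funs A. \<forall>X\<in>vector_fields A.
        \<omega> (vs[i := act f X]) = sm f (\<omega> (vs[i := X]))) \<and>
     (\<forall>vs\<in>args A k. \<forall>i<k. \<forall>j<k. i \<noteq> j \<and> vs ! i = vs ! j \<longrightarrow> \<omega> vs = 0)}"

type_synonym 'a form = "'a vf list \<Rightarrow> 'a fn"
type_synonym 'a covform = "'a vf list \<Rightarrow> 'a vf \<Rightarrow> 'a fn"
type_synonym 'a endform = "'a vf list \<Rightarrow> 'a vf \<Rightarrow> 'a vf"

(* k-forms with values in R, T^*Y and End(TY); in m vs Y the list vs holds the form arguments and
   Y is plugged into the T^*Y factor, so m_Y = (\<lambda>vs. m vs Y). *)
definition Omega :: "'a chart set \<Rightarrow> nat \<Rightarrow> 'a form set" where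
  "Omega A k = alt_maps A (*) (smooth_funs A) k"

definition Omega_cov :: "'a chart set \<Rightarrow> nat \<Rightarrow> 'a covform set" where
  "Omega_cov A k = alt_maps A act (covectors A) k"

definition Omega_End :: "'a chart set \<Rightarrow> nat \<Rightarrow> 'a endform set" where
  "Omega_End A k = alt_maps A (\<lambda>f S Y. act f (S Y)) (endos A) k"

(* Wedge product of a p-form and a q-form with respect to the pairing mul of their values; the
   normalisation makes (e^1 \<and> e^2)(X,Y) = e^1(X) e^2(Y) - e^1(Y) e^2(X). *)
definition wedge ::
  "'a chart set \<Rightarrow> ('b \<Rightarrow> 'c \<Rightarrow> 'a fn) \<Rightarrow> nat \<Rightarrow> nat \<Rightarrow>
     ('a vf list \<Rightarrow> 'b) \<Rightarrow> ('a vf list \<Rightarrow> 'c) \<Rightarrow> 'a form" where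
  "wedge A mul p q \<alpha> \<beta> = (\<lambda>vs. if vs \<in> args A (p + q) then
     (\<lambda>x. (\<Sum>\<sigma> | \<sigma> permutes {..<p + q}. of_int (sign \<sigma>) *
              mul (\<alpha> (map (\<lambda>a. vs ! \<sigma> a) [0..<p])) (\<beta> (map (\<lambda>a. vs ! \<sigma> a) [p..<p + q])) x)
          / (fact p * fact q))
     else 0)"

definition omit :: "nat \<Rightarrow> 'b list \<Rightarrow> 'b list" where
  "omit i xs = take i xs @ drop (Suc i) xs"

(* Exterior derivative of a k-form, by the invariant formula. *)
definition ext_d :: "'a chart set \<Rightarrow> nat \<Rightarrow> 'a form \<Rightarrow> 'a form" where
  "ext_d A k \<omega> = (\<lambda>vs. if vs \<in> args A (Suc k) then
     (\<lambda>x. (\<Sum>i\<le>k. (-1) ^ i * (vs ! i) (\<omega> (omit i vs)) x) +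
          (\<Sum>j\<le>k. \<Sum>i<j. (-1) ^ (i + j) *
             \<omega> (bracket (vs ! i) (vs ! j) # omit i (omit j vs)) x))
     else 0)"

section \<open>Frames, metric and trace\<close>

(* The values of E 1, ..., E 7 at x form a basis of the tangent space at x. *)
definition frame_at :: "'a chart set \<Rightarrow> 'a \<Rightarrow> (nat \<Rightarrow> 'a vf) \<Rightarrow> bool" where
  "frame_at A x E \<longleftrightarrow>
     (\<forall>i\<in>{1..7}. E i \<in> vector_fields A) \<and>
     (\<forall>v\<in>tangent_space A x. \<exists>c. \<forall>f. v f = (\<Sum>i=1..7. c i * E i f x)) \<and>
     (\<forall>c. (\<forall>f. (\<Sum>i=1..7. c i * E i f x) = 0) \<longrightarrow> (\<forall>i\<in>{1..7}. c i = 0))"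

(* Matrix trace at x: c is the matrix of S at x with respect to the frame E, and the sum of the
   diagonal entries does not depend on E. *)
definition trace_end :: "'a chart set \<Rightarrow> ('a vf \<Rightarrow> 'a vf) \<Rightarrow> 'a fn" where
  "trace_end A S = (\<lambda>x. THE t. \<exists>E c. frame_at A x E \<and>
     (\<forall>i\<in>{1..7}. \<forall>f. S (E i) f x = (\<Sum>j=1..7. c j i * E j f x)) \<and>
     t = (\<Sum>i=1..7. c i i))"

definition tau :: "'a chart set \<Rightarrow> ('a vf \<Rightarrow> 'a vf) \<Rightarrow> ('a vf \<Rightarrow> 'a vf) \<Rightarrow> 'a fn" where
  "tau A S T = trace_end A (S \<circ> T)"

type_synonym 'a metric = "'a vf \<Rightarrow> 'a vf \<Rightarrow> 'a fn"

definition riemannian_metric :: "'a chart set \<Rightarrow> 'a metric \<Rightarrow> bool" where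
  "riemannian_metric A g \<longleftrightarrow>
     g \<in> lin_maps A act (covectors A) \<and>
     (\<forall>X\<in>vector_fields A. \<forall>Y\<in>vector_fields A. g X Y = g Y X) \<and>
     (\<forall>X\<in>vector_fields A. \<forall>x. (\<exists>f. X f x \<noteq> 0) \<longrightarrow> g X X x > 0)"

definition on_frame_at :: "'a chart set \<Rightarrow> 'a metric \<Rightarrow> 'a \<Rightarrow> (nat \<Rightarrow> 'a vf) \<Rightarrow> bool" where
  "on_frame_at A g x E \<longleftrightarrow> frame_at A x E \<and>
     (\<forall>i\<in>{1..7}. \<forall>j\<in>{1..7}. g (E i) (E j) x = (if i = j then 1 else 0))"

(* Inner product of k-forms, for which the e^{i_1...i_k} with i_1 < ... < i_k are orthonormal; it
   does not depend on the orthonormal frame. *)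
definition form_inner :: "'a chart set \<Rightarrow> 'a metric \<Rightarrow> nat \<Rightarrow> 'a form \<Rightarrow> 'a form \<Rightarrow> 'a fn" where
  "form_inner A g k \<alpha> \<beta> = (\<lambda>x. let E = (SOME E. on_frame_at A g x E) in
     (\<Sum>is | length is = k \<and> set is \<subseteq> {1..7}. \<alpha> (map E is) x * \<beta> (map E is) x) / fact k)"

definition hodge :: "'a chart set \<Rightarrow> 'a metric \<Rightarrow> 'a form \<Rightarrow> nat \<Rightarrow> 'a form \<Rightarrow> 'a form" where
  "hodge A g vol k \<omega> = (THE \<eta>. \<eta> \<in> Omega A (7 - k) \<and>
     (\<forall>\<alpha>\<in>Omega A k. \<forall>vs.
        wedge A (*) k (7 - k) \<alpha> \<eta> vs = form_inner A g k \<alpha> \<omega> * vol vs))"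

section \<open>Torsion-free G2 structures\<close>

(* The form e^{i_1...i_k}; e i is the i-th member of the coframe. *)
definition e_form :: "(nat \<Rightarrow> 'a vf \<Rightarrow> 'a fn) \<Rightarrow> nat list \<Rightarrow> 'a form" where
  "e_form e is vs x = (\<Sum>\<sigma> | \<sigma> permutes {..<length is}. of_int (sign \<sigma>) *
     (\<Prod>a<length is. e (is ! a) (vs ! \<sigma> a) x))"

definition phi_std :: "(nat \<Rightarrow> 'a vf \<Rightarrow> 'a fn) \<Rightarrow> 'a form" where
  "phi_std e = e_form e [1,2,3] + e_form e [1,4,5] + e_form e [1,6,7] + e_form e [2,4,6]
     - e_form e [2,5,7] - e_form e [3,4,7] - e_form e [3,5,6]"

(* The positive form \<phi> with its associated metric g and orientation; the orientation is given by
   the Riemannian volume form vol.  The local coframe is e^i = g(E_i, -), dual to the orthonormal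
   frame E, and g and vol are determined by \<phi>.  A local frame is taken as the restriction to U of
   globally defined vector fields, which is no loss after shrinking U. *)
definition G2_structure ::
  "'a::topological_space chart set \<Rightarrow> 'a form \<Rightarrow> 'a metric \<Rightarrow> 'a form \<Rightarrow> bool" where
  "G2_structure A \<phi> g vol \<longleftrightarrow>
     \<phi> \<in> Omega A 3 \<and> riemannian_metric A g \<and> vol \<in> Omega A 7 \<and>
     (\<forall>p. \<exists>U E. open U \<and> p \<in> U \<and> (\<forall>x\<in>U. on_frame_at A g x E \<and>
        (\<forall>vs\<in>args A 3. \<phi> vs x = phi_std (\<lambda>i. g (E i)) vs x) \<and>
        (\<forall>vs\<in>args A 7. vol vs x = e_form (\<lambda>i. g (E i)) [1,2,3,4,5,6,7] vs x)))"

definition torsion_free :: "'a chart set \<Rightarrow> 'a form \<Rightarrow> 'a metric \<Rightarrow> 'a form \<Rightarrow> bool" where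
  "torsion_free A \<phi> g vol \<longleftrightarrow> ext_d A 3 \<phi> = 0 \<and> ext_d A 4 (hodge A g vol 3 \<phi>) = 0"

section \<open>Levi-Civita connection and curvature\<close>

type_synonym 'a connection = "'a vf \<Rightarrow> 'a vf \<Rightarrow> 'a vf"

(* D X Y is the covariant derivative of Y along X. *)
definition levi_civita :: "'a chart set \<Rightarrow> 'a metric \<Rightarrow> 'a connection \<Rightarrow> bool" where
  "levi_civita A g D \<longleftrightarrow>
     (\<forall>X\<in>vector_fields A. \<forall>Y\<in>vector_fields A. D X Y \<in> vector_fields A) \<and>
     (\<forall>X\<in>vector_fields A. \<forall>X'\<in>vector_fields A. \<forall>Y\<in>vector_fields A.
        D (X + X') Y = D X Y + D X' Y) \<and>
     (\<forall>f\<in>smooth_funs A. \<forall>X\<in>vector_fields A. \<forall>Y\<in>vector_fields A.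
        D (act f X) Y = act f (D X Y)) \<and>
     (\<forall>X\<in>vector_fields A. \<forall>Y\<in>vector_fields A. \<forall>Y'\<in>vector_fields A.
        D X (Y + Y') = D X Y + D X Y') \<and>
     (\<forall>f\<in>smooth_funs A. \<forall>X\<in>vector_fields A. \<forall>Y\<in>vector_fields A.
        D X (act f Y) = act (X f) Y + act f (D X Y)) \<and>
     (\<forall>X\<in>vector_fields A. \<forall>Y\<in>vector_fields A. \<forall>Z\<in>vector_fields A.
        X (g Y Z) = g (D X Y) Z + g Y (D X Z)) \<and>
     (\<forall>X\<in>vector_fields A. \<forall>Y\<in>vector_fields A. D X Y - D Y X = bracket X Y)"

definition curvature :: "'a connection \<Rightarrow> 'a vf \<Rightarrow> 'a vf \<Rightarrow> 'a vf \<Rightarrow> 'a vf" where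
  "curvature D X Y Z = D X (D Y Z) - D Y (D X Z) - D (bracket X Y) Z"

(* \<iota>_Z R as an End(TY)-valued one-form. *)
definition iota_R :: "'a chart set \<Rightarrow> 'a connection \<Rightarrow> 'a vf \<Rightarrow> 'a endform" where
  "iota_R A D Z = (\<lambda>vs Y. if vs \<in> args A 1 \<and> Y \<in> vector_fields A
     then curvature D Z (vs ! 0) Y else 0)"

(* cov D X m vs Y = (\<nabla>_X m)_Y evaluated on the form arguments vs. *)
definition cov :: "'a connection \<Rightarrow> 'a vf \<Rightarrow> 'a covform \<Rightarrow> 'a covform" where
  "cov D X m = (\<lambda>vs Y. X (m vs Y) - (\<Sum>i<length vs. m (vs[i := D X (vs ! i)]) Y) - m vs (D X Y))"

section \<open>Canonical cochains\<close>

(* Sections of the canonical subbundles; in degree 2 this is \<Lambda>^2_7. *)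
definition Lambda_can :: "'a chart set \<Rightarrow> 'a form \<Rightarrow> nat \<Rightarrow> 'a form set" where
  "Lambda_can A \<phi> k =
     (if k \<le> 1 then Omega A k
      else if k = 2 then {(\<lambda>vs. \<phi> (X # vs)) | X. X \<in> vector_fields A}
      else if k = 3 then {act f \<phi> | f. f \<in> smooth_funs A}
      else {0})"

definition proj_form :: "'a chart set \<Rightarrow> 'a form \<Rightarrow> 'a metric \<Rightarrow> nat \<Rightarrow> 'a form \<Rightarrow> 'a form" where
  "proj_form A \<phi> g k \<omega> = (THE \<eta>. \<eta> \<in> Lambda_can A \<phi> k \<and>
     (\<forall>\<zeta>\<in>Lambda_can A \<phi> k. form_inner A g k (\<omega> - \<eta>) \<zeta> = 0))"

(* \<Pi>_k acts on the form part of a T^*Y-valued form. *)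
definition proj_cov :: "'a chart set \<Rightarrow> 'a form \<Rightarrow> 'a metric \<Rightarrow> nat \<Rightarrow> 'a covform \<Rightarrow> 'a covform" where
  "proj_cov A \<phi> g k m = (\<lambda>vs Z. proj_form A \<phi> g k (\<lambda>us. m us Z) vs)"

definition G0 :: "'a chart set \<Rightarrow> 'a form \<Rightarrow> nat \<Rightarrow> 'a covform set" where
  "G0 A \<phi> k = {m \<in> Omega_cov A k. \<forall>Y\<in>vector_fields A. (\<lambda>vs. m vs Y) \<in> Lambda_can A \<phi> k}"

section \<open>The operators\<close>

(* A pair (u, v) stands for u + \<epsilon> v with \<epsilon>^2 = 0, so that elements of \<epsilon> C(T^*Y) are
   the pairs (0, v). *)
definition eps :: "'b::zero \<times> 'b \<Rightarrow> 'b \<times> 'b" where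
  "eps u = (0, fst u)"

(* The End(TY)-valued p-form b with g(X, b Y) = \<beta>(X, Y). *)
definition raise_index ::
  "'a chart set \<Rightarrow> 'a metric \<Rightarrow> nat \<Rightarrow> ('a vf list \<Rightarrow> 'a vf \<Rightarrow> 'a vf \<Rightarrow> 'a fn) \<Rightarrow> 'a endform" where
  "raise_index A g p \<beta> = (THE b. b \<in> Omega_End A p \<and>
     (\<forall>vs\<in>args A p. \<forall>X\<in>vector_fields A. \<forall>Y\<in>vector_fields A. g X (b vs Y) = \<beta> vs X Y))"

definition op_B :: "'a chart set \<Rightarrow> 'a metric \<Rightarrow> 'a connection \<Rightarrow> nat \<Rightarrow> 'a covform \<Rightarrow> 'a endform" where
  "op_B A g D p m = raise_index A g p (\<lambda>vs X Y. cov D X m vs Y)"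

definition op_K :: "'a chart set \<Rightarrow> 'a metric \<Rightarrow> 'a connection \<Rightarrow> nat \<Rightarrow> 'a covform \<Rightarrow> 'a endform" where
  "op_K A g D p m = raise_index A g p (\<lambda>vs X Y. cov D Y m vs X - cov D X m vs Y)"

(* The T^*Y-valued (p+1)-form Z \<mapsto> r \<tau>(\<iota>_Z R \<and> a). *)
definition curv_pairing ::
  "'a chart set \<Rightarrow> 'a connection \<Rightarrow> real \<Rightarrow> nat \<Rightarrow> 'a endform \<Rightarrow> 'a covform" where
  "curv_pairing A D r p a = (\<lambda>vs Z. if Z \<in> vector_fields A
     then (\<lambda>x. r * wedge A (tau A) 1 p (iota_R A D Z) a vs x) else 0)"

(* The unprojected operators on p-forms.  The formula for op_b makes sense for all
   End(TY)-valued forms; it is used on trace-free ones. *)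
definition op_b ::
  "'a chart set \<Rightarrow> 'a connection \<Rightarrow> nat \<Rightarrow> 'a endform \<Rightarrow> 'a covform \<times> 'a covform" where
  "op_b A D p a = eps (curv_pairing A D (- 1 / 4) p a, 0)"

definition op_c ::
  "'a chart set \<Rightarrow> 'a metric \<Rightarrow> 'a connection \<Rightarrow> nat \<Rightarrow> 'a covform \<Rightarrow> 'a covform \<times> 'a covform" where
  "op_c A g D p m = eps (curv_pairing A D (- 1 / 2) p (op_B A g D p m), 0)"

(* The maps into G_1^{k+1}. *)
definition can_b ::
  "'a chart set \<Rightarrow> 'a form \<Rightarrow> 'a metric \<Rightarrow> 'a connection \<Rightarrow> nat \<Rightarrow> 'a endform \<Rightarrow>
     'a covform \<times> 'a covform" where
  "can_b A \<phi> g D k a = map_prod (proj_cov A \<phi> g (k + 1)) (proj_cov A \<phi> g (k + 1)) (op_b A D k a)"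

definition can_c ::
  "'a chart set \<Rightarrow> 'a form \<Rightarrow> 'a metric \<Rightarrow> 'a connection \<Rightarrow> nat \<Rightarrow> 'a covform \<Rightarrow>
     'a covform \<times> 'a covform" where
  "can_c A \<phi> g D k m = map_prod (proj_cov A \<phi> g (k + 1)) (proj_cov A \<phi> g (k + 1)) (op_c A g D k m)"

end

theory Submission
  imports Defs
begin

text \<open>
  Put \<open>B = \<B>(m)\<close>.  By definition \<open>g(X, (\<K>m) Y) = g(Y, B X) - g(X, B Y)\<close>, that is,
  \<open>\<K>m = B\<^sup>T - B\<close>.  The Levi-Civita connection is metric, so \<open>R = R(Z, V)\<close> is skew, and
  \<open>tr(R B\<^sup>T) = tr(B R\<^sup>T) = - tr(R B)\<close>.  Hence \<open>\<tau>(\<iota>\<^sub>Z R \<and> \<K>m) = - 2 \<tau>(\<iota>\<^sub>Z R \<and> B)\<close>, and the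
  coefficients \<open>-1/4\<close> and \<open>-1/2\<close> are such that the two couplings cancel before any projection.
  This is \<open>tau_skew\<close> pointwise and \<open>curv_pairing_K\<close> for forms.

  The operators are defined by descriptions (the endomorphism with given metric pairing, the trace in
  some frame, the orthogonal projection), so most of the work is to show that the described objects
  exist and are unique.
  Everything rests on one locality statement, \<open>tensorial_pointwise\<close>: a map on vector fields that is
  linear over the smooth functions depends at a point only on the value of the field there.  It needs
  bump functions, which are built from \<open>exp (-1/t)\<close>, and Cramer's rule in a local frame.  It gives
  expansions in orthonormal frames; with these the inverse of the musical isomorphism exists
  (\<open>sharp_exists\<close>), an index of a bilinear form can be raised (\<open>raise_index_spec\<close>) and the trace is
  independent of the frame (\<open>trace_end_frame\<close>).

  The identity for the projected operators follows from the unprojected one once the projections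
  commute with the sign change, \<open>\<Pi>(- u) = - \<Pi> u\<close> (\<open>proj_form_uminus\<close>).  Orthogonal projections
  onto \<open>\<Lambda>\<^sup>2\<^sub>7\<close> and \<open>\<Lambda>\<^sup>3\<^sub>1\<close> are given by explicit formulas because
  \<open>\<langle>\<iota>\<^sub>X \<phi>, \<iota>\<^sub>Y \<phi>\<rangle> = 3 g(X, Y)\<close> and \<open>\<langle>\<phi>, \<phi>\<rangle> = 7\<close>, which is a finite computation in a \<open>G\<^sub>2\<close> frame.
\<close>


section \<open>Smooth functions on open subsets of Euclidean space\<close>

lemma Ck_on_cong:
  fixes f f' :: "'v::euclidean_space \<Rightarrow> 'w::real_normed_vector"
  assumes "open S" "\<And>x. x \<in> S \<Longrightarrow> f x = f' x" "Ck_on k S f"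
  shows "Ck_on k S f'"
  using assms(2,3)
proof (induction k arbitrary: f f')
  case 0
  then show ?case by (auto cong: continuous_on_cong)
next
  case (Suc k)
  have d: "(f' has_derivative frechet_derivative f (at x)) (at x)" if "x \<in> S" for x
  proof -
    have "(f has_derivative frechet_derivative f (at x)) (at x)"
      using Suc.prems(2) that frechet_derivative_works by auto
    then show ?thesis
      by (rule has_derivative_transform_within_open[OF _ \<open>open S\<close> that]) (use Suc.prems(1) in auto)
  qed
  have eq: "frechet_derivative f' (at x) = frechet_derivative f (at x)" if "x \<in> S" for x
    using frechet_derivative_at[OF d[OF that]] by simp
  show ?case
  proof (simp, intro conjI ballI allI)
    fix x assume "x \<in> S"
    then show "f' differentiable at x" using d differentiable_def by blast
  next
    fix v
    show "Ck_on k S (\<lambda>x. frechet_derivative f' (at x) v)"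
      by (rule Suc.IH[of "\<lambda>x. frechet_derivative f (at x) v"]) (use eq Suc.prems in auto)
  qed
qed

lemma Ck_on_subset:
  assumes "Ck_on k S f" "T \<subseteq> S" shows "Ck_on k T f"
  using assms(1) by (induction k arbitrary: f) (use assms(2) continuous_on_subset in auto)

lemma Ck_on_local:
  assumes "\<And>x. x \<in> S \<Longrightarrow> \<exists>T. open T \<and> x \<in> T \<and> Ck_on k T f"
  shows "Ck_on k S f"
  using assms
proof (induction k arbitrary: f)
  case 0
  have "isCont f x" if x: "x \<in> S" for x
    using 0[OF x] continuous_on_eq_continuous_at by auto
  then show ?case by (simp add: continuous_at_imp_continuous_on)
next
  case (Suc k)
  show ?case
  proof (simp, intro conjI ballI allI)
    fix x assume "x \<in> S"
    then show "f differentiable at x" using Suc.prems[of x] by auto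
  next
    fix v
    show "Ck_on k S (\<lambda>x. frechet_derivative f (at x) v)"
      by (rule Suc.IH) (use Suc.prems in fastforce)
  qed
qed

lemma Ck_on_SucD: "Ck_on (Suc k) S f \<Longrightarrow> Ck_on k S f"
proof (induction k arbitrary: f)
  case 0
  then show ?case
    by (auto intro!: continuous_at_imp_continuous_on differentiable_imp_continuous_within)
next
  case (Suc k)
  have "Ck_on k S (\<lambda>x. frechet_derivative f (at x) v)" for v
    using Suc.prems by (intro Suc.IH) simp
  then show ?case using Suc.prems by simp
qed

text \<open>The shape in which all closure properties below are proved: it is enough to know some
  formula for the derivative on the open set, and that this formula is one degree less smooth.\<close>

lemma Ck_on_SucI:
  assumes "open S"
    and "\<And>x. x \<in> S \<Longrightarrow> (f has_derivative f' x) (at x)"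
    and "\<And>v. Ck_on k S (\<lambda>x. f' x v)"
  shows "Ck_on (Suc k) S f"
proof (simp, intro conjI ballI allI)
  fix x assume "x \<in> S"
  then show "f differentiable at x" using assms(2) differentiable_def by blast
next
  fix v
  show "Ck_on k S (\<lambda>x. frechet_derivative f (at x) v)"
    by (rule Ck_on_cong[OF assms(1) _ assms(3)[of v]])
       (use assms(2) frechet_derivative_at in \<open>metis\<close>)
qed

lemma Ck_on_SucE:
  assumes "Ck_on (Suc k) S f" "x \<in> S"
  shows "(f has_derivative frechet_derivative f (at x)) (at x)"
  using assms frechet_derivative_works by auto

lemma Ck_on_const: "open S \<Longrightarrow> Ck_on k S (\<lambda>x. c)"
proof (induction k arbitrary: c)
  case (Suc k)
  show ?case by (rule Ck_on_SucI[where f' = "\<lambda>x v. 0"]) (use Suc in auto)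
qed simp

lemma Ck_on_add:
  assumes "open S" "Ck_on k S f" "Ck_on k S h"
  shows "Ck_on k S (\<lambda>x. f x + h x)"
  using assms(2,3)
proof (induction k arbitrary: f h)
  case 0 then show ?case by (auto intro: continuous_intros)
next
  case (Suc k)
  show ?case
    by (rule Ck_on_SucI[OF \<open>open S\<close> has_derivative_add[OF Ck_on_SucE Ck_on_SucE]])
       (use Suc in auto)
qed

lemma Ck_on_sum:
  assumes "open S" "\<And>i. i \<in> I \<Longrightarrow> Ck_on k S (f i)"
  shows "Ck_on k S (\<lambda>x. \<Sum>i\<in>I. f i x)"
  using assms(2)
  by (induction I rule: infinite_finite_induct)
     (auto intro!: Ck_on_add Ck_on_const \<open>open S\<close> simp: Ck_on_const[OF \<open>open S\<close>])

lemma Ck_on_mult: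
  fixes f h :: "'v::euclidean_space \<Rightarrow> real"
  assumes "open S" "Ck_on k S f" "Ck_on k S h"
  shows "Ck_on k S (\<lambda>x. f x * h x)"
  using assms(2,3)
proof (induction k arbitrary: f h)
  case 0 then show ?case by (auto intro: continuous_intros)
next
  case (Suc k)
  show ?case
    by (rule Ck_on_SucI[OF \<open>open S\<close> has_derivative_mult[OF Ck_on_SucE Ck_on_SucE]])
       (use Suc in \<open>auto intro!: Ck_on_add Suc.IH intro: Ck_on_SucD \<open>open S\<close>\<close>)
qed

lemma Ck_on_bounded_linear:
  assumes "bounded_linear L" "open S" "Ck_on k S f"
  shows "Ck_on k S (\<lambda>x. L (f x))"
  using assms(3)
proof (induction k arbitrary: f)
  case 0 then show ?case
    using bounded_linear.continuous_on[OF assms(1)] by auto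
next
  case (Suc k)
  show ?case
    by (rule Ck_on_SucI[OF \<open>open S\<close> bounded_linear.has_derivative[OF assms(1) Ck_on_SucE]])
       (use Suc in auto)
qed

lemma Ck_on_linear:
  assumes "bounded_linear L" "open S" shows "Ck_on k S L"
proof (cases k)
  case 0 then show ?thesis using assms(1) by (simp add: linear_continuous_on)
next
  case (Suc j)
  then show ?thesis
    using Ck_on_SucI[OF assms(2) bounded_linear_imp_has_derivative[OF assms(1)]
        Ck_on_const[OF assms(2)]] by metis
qed

text \<open>Partial derivatives of \<open>f\<close> in a basis turn the chain rule into a sum of products, to which the
  induction hypothesis and the product rule apply; \<open>h\<close> loses a derivative too, hence the
  assumption on \<open>h\<close> in all degrees.\<close>

lemma Ck_on_compose:
  fixes f :: "'w::euclidean_space \<Rightarrow> real" and h :: "'v::euclidean_space \<Rightarrow> 'w"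
  assumes S: "open S" and T: "open T" "h ` S \<subseteq> T"
    and "Ck_on k T f" and h: "\<And>k. Ck_on k S h"
  shows "Ck_on k S (\<lambda>x. f (h x))"
  using assms(4)
proof (induction k arbitrary: f)
  case 0 then show ?case
    using h[of 0] T(2) by (auto intro: continuous_on_compose2)
next
  case (Suc k)
  let ?D = "\<lambda>x v. \<Sum>b\<in>Basis. (frechet_derivative h (at x) v \<bullet> b) * frechet_derivative f (at (h x)) b"
  show ?case
  proof (rule Ck_on_SucI[OF S, where f' = ?D])
    fix x assume x: "x \<in> S"
    have df: "(f has_derivative frechet_derivative f (at (h x))) (at (h x))"
      using Suc.prems x T(2) by (intro Ck_on_SucE) auto
    have dh: "(h has_derivative frechet_derivative h (at x)) (at x)"
      using h x by (rule Ck_on_SucE)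
    interpret lf: bounded_linear "frechet_derivative f (at (h x))"
      using df by (rule has_derivative_bounded_linear)
    have eq: "frechet_derivative f (at (h x)) w
        = (\<Sum>b\<in>Basis. (w \<bullet> b) * frechet_derivative f (at (h x)) b)" for w
      by (subst euclidean_representation[of w, symmetric])
         (simp only: lf.sum lf.scaleR real_scaleR_def)
    show "((\<lambda>x. f (h x)) has_derivative ?D x) (at x)"
      by (rule has_derivative_eq_rhs[OF has_derivative_compose[OF dh df] ext[OF eq]])
  next
    fix v
    have "Ck_on k S (\<lambda>x. frechet_derivative h (at x) v \<bullet> b)" for b
      using h[of "Suc k"] by (intro Ck_on_bounded_linear[OF bounded_linear_inner_left S]) simp
    then show "Ck_on k S (\<lambda>x. ?D x v)"
      using Suc by (intro Ck_on_sum Ck_on_mult S Suc.IH) auto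
  qed
qed

section \<open>Bump functions\<close>

text \<open>Dividing by powers of the variable keeps the family closed under differentiation, so that
  smoothness at the origin follows for the whole family at once.\<close>

definition flat :: "nat \<Rightarrow> real \<Rightarrow> real" where
  "flat n t = (if t > 0 then inverse t ^ n * exp (- inverse t) else 0)"

lemma flat_tendsto_0: "(flat n \<longlongrightarrow> 0) (at 0)"
proof -
  have "((\<lambda>t. inverse t ^ n / exp (inverse t)) \<longlongrightarrow> 0) (at_right (0::real))"
    by (rule filterlim_compose[OF tendsto_power_div_exp_0 filterlim_inverse_at_top_right])
  moreover have "eventually (\<lambda>t. inverse t ^ n / exp (inverse t) = flat n t) (at_right 0)"
    by (auto simp: eventually_at_filter flat_def exp_minus field_simps)
  ultimately have r: "(flat n \<longlongrightarrow> 0) (at_right 0)"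
    by (rule Lim_transform_eventually)
  have "eventually (\<lambda>t. 0 = flat n t) (at_left 0)"
    by (auto simp: eventually_at_filter flat_def)
  then have "(flat n \<longlongrightarrow> 0) (at_left 0)"
    by (rule Lim_transform_eventually[OF tendsto_const])
  with r show ?thesis by (simp add: filterlim_split_at)
qed

text \<open>At the origin the difference quotient of a member of the family is again a member.\<close>

lemma flat_has_derivative:
  "(flat n has_real_derivative flat (n + 2) t - real n * flat (Suc n) t) (at t)"
proof (cases t "0::real" rule: linorder_cases)
  case less
  have "((\<lambda>_. 0) has_real_derivative 0) (at t)" by simp
  then have "(flat n has_real_derivative 0) (at t)"
    by (rule has_field_derivative_transform_within_open[OF _ open_lessThan[of 0]])
       (use less in \<open>auto simp: flat_def\<close>)
  then show ?thesis using less by (simp add: flat_def)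
next
  case equal
  have "((\<lambda>y. (flat n y - flat n 0) / (y - 0)) \<longlongrightarrow> 0) (at 0)"
    by (rule Lim_transform_eventually[OF flat_tendsto_0[of "Suc n"]])
       (auto simp: eventually_at_filter flat_def field_simps)
  then show ?thesis
    using equal by (simp add: has_field_derivative_iff flat_def)
next
  case greater
  define s where "s = inverse t"
  have "((\<lambda>t. inverse t ^ n * exp (- inverse t)) has_real_derivative
      real n * (- (s * s)) * s ^ (n - 1) * exp (- s) + s ^ n * (exp (- s) * (s * s))) (at t)"
    using greater by (auto intro!: derivative_eq_intros simp: s_def)
  moreover have "real n * (- (s * s)) * s ^ (n - 1) * exp (- s) + s ^ n * (exp (- s) * (s * s))
      = flat (n + 2) t - real n * flat (Suc n) t"
    using greater by (cases n) (simp_all add: flat_def s_def[symmetric] algebra_simps)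
  ultimately have "((\<lambda>t. inverse t ^ n * exp (- inverse t)) has_real_derivative
      flat (n + 2) t - real n * flat (Suc n) t) (at t)"
    by simp
  then show ?thesis
    by (rule has_field_derivative_transform_within_open[OF _ open_greaterThan[of 0]])
       (use greater in \<open>auto simp: flat_def\<close>)
qed

lemma flat_Ck: "Ck_on k UNIV (flat n)"
proof (induction k arbitrary: n)
  case 0
  show ?case using DERIV_isCont[OF flat_has_derivative]
    by (auto intro!: continuous_at_imp_continuous_on)
next
  case (Suc k)
  show ?case
  proof (rule Ck_on_SucI)
    show "(flat n has_derivative (\<lambda>v. (flat (n + 2) x - real n * flat (Suc n) x) * v)) (at x)" for x
      using flat_has_derivative[of n x] by (simp add: has_field_derivative_def)
    show "Ck_on k UNIV (\<lambda>x. (flat (n + 2) x - real n * flat (Suc n) x) * v)" for v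
      using Ck_on_add[OF open_UNIV Suc[of "n + 2"]
          Ck_on_mult[OF open_UNIV Ck_on_const[OF open_UNIV, of _ "- real n"] Suc[of "Suc n"]]]
      by (intro Ck_on_mult Ck_on_const) simp_all
  qed simp
qed

lemma Ck_on_bump:
  fixes c :: "'v::euclidean_space"
  shows "Ck_on k UNIV (\<lambda>y. flat 0 (r\<^sup>2 - (y - c) \<bullet> (y - c)))"
proof (rule Ck_on_compose[OF open_UNIV open_UNIV _ flat_Ck])
  fix k
  have lin: "Ck_on k UNIV (\<lambda>y. y \<bullet> b + d)" for b d
    by (intro Ck_on_add Ck_on_linear[OF bounded_linear_inner_left] Ck_on_const) auto
  have "Ck_on k UNIV (\<lambda>y::'v. r\<^sup>2 + (\<Sum>b\<in>Basis. - 1 * ((y \<bullet> b + - (c \<bullet> b)) * (y \<bullet> b + - (c \<bullet> b)))))"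
    by (intro Ck_on_add Ck_on_sum Ck_on_mult Ck_on_const lin) auto
  moreover have "(y - c) \<bullet> (y - c) = (\<Sum>b\<in>Basis. (y \<bullet> b - c \<bullet> b) * (y \<bullet> b - c \<bullet> b))" for y
    by (subst euclidean_inner) (simp add: inner_diff_left)
  ultimately show "Ck_on k UNIV (\<lambda>y. r\<^sup>2 - (y - c) \<bullet> (y - c))"
    by (simp add: sum_negf)
qed simp

section \<open>Smooth functions and vector fields on a manifold\<close>

lemma sum_fun_apply: "(\<Sum>i\<in>I. F i) x = (\<Sum>i\<in>I. F i x)"
  by (induction I rule: infinite_finite_induct) auto

lemma act_apply [simp]: "act f X h x = f x * X h x"
  by (simp add: act_def)

locale smooth_manifold =
  fixes A :: "'a::t2_space chart set"
  assumes atlas: "smooth_atlas A"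
begin

abbreviation "C \<equiv> smooth_funs A"
abbreviation "VF \<equiv> vector_fields A"

lemma chart:
  assumes "(U, x) \<in> A"
  shows "open U" "open (x ` U)" "homeomorphism U (x ` U) x (inv_into U x)" "inj_on x U"
proof -
  show "open U" "open (x ` U)" and h: "homeomorphism U (x ` U) x (inv_into U x)"
    using assms atlas by (auto simp: smooth_atlas_def is_chart_def)
  show "inj_on x U" by (metis h homeomorphism_apply1 inj_onI)
qed

lemma chart_image_open:
  assumes "(U, x) \<in> A" "open W" shows "open (x ` (U \<inter> W))"
proof -
  have "openin (top_of_set (x ` U)) (x ` (U \<inter> W))"
    using chart[OF assms(1)] assms(2)
    by (intro homeomorphism_imp_open_map) (auto intro: openin_open_Int)
  then show ?thesis using chart(2)[OF assms(1)] openin_open_trans by blast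
qed

lemma chart_at: obtains U x where "(U, x) \<in> A" "p \<in> U"
  using atlas unfolding smooth_atlas_def by blast

lemma smooth_funsI:
  assumes "\<And>U x k. (U, x) \<in> A \<Longrightarrow> Ck_on k (x ` U) (f \<circ> inv_into U x)"
  shows "f \<in> C"
  using assms by (auto simp: smooth_funs_def smooth_on_def)

lemma smooth_funsD: "f \<in> C \<Longrightarrow> (U, x) \<in> A \<Longrightarrow> Ck_on k (x ` U) (f \<circ> inv_into U x)"
  by (auto simp: smooth_funs_def smooth_on_def)

lemma const_smooth [intro, simp]: "(\<lambda>_. c) \<in> C"
  using chart by (auto intro!: smooth_funsI Ck_on_const simp: comp_def)

lemma zero_smooth [intro, simp]: "0 \<in> C" and one_smooth [intro, simp]: "1 \<in> C"
  by (simp_all add: zero_fun_def one_fun_def)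

lemma add_smooth [intro]: "f \<in> C \<Longrightarrow> h \<in> C \<Longrightarrow> f + h \<in> C"
  using chart(2) by (intro smooth_funsI)
    (simp add: comp_def Ck_on_add smooth_funsD[unfolded comp_def])

lemma mult_smooth [intro]: "f \<in> C \<Longrightarrow> h \<in> C \<Longrightarrow> f * h \<in> C"
  using chart(2) by (intro smooth_funsI)
    (simp add: comp_def Ck_on_mult smooth_funsD[unfolded comp_def])

lemma scale_smooth [intro]: "f \<in> C \<Longrightarrow> (\<lambda>x. r * f x) \<in> C"
  using mult_smooth[OF const_smooth[of r]] by (simp add: times_fun_def)

lemma uminus_smooth [intro]: "f \<in> C \<Longrightarrow> - f \<in> C"
  using scale_smooth[of f "- 1"] by (simp add: fun_Compl_def)

lemma diff_smooth [intro]: "f \<in> C \<Longrightarrow> h \<in> C \<Longrightarrow> f - h \<in> C"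
  using add_smooth[OF _ uminus_smooth, of f h] by simp

lemma sum_smooth [intro]: "(\<And>i. i \<in> I \<Longrightarrow> f i \<in> C) \<Longrightarrow> sum f I \<in> C"
  by (induction I rule: infinite_finite_induct) auto

lemma sum_smooth_pointwise [intro]: "(\<And>i. i \<in> I \<Longrightarrow> f i \<in> C) \<Longrightarrow> (\<lambda>x. \<Sum>i\<in>I. f i x) \<in> C"
  using sum_smooth[of I f] by (simp add: sum_fun_apply[abs_def] cong: sum.cong)

lemma prod_smooth: "(\<And>i. i \<in> I \<Longrightarrow> f i \<in> C) \<Longrightarrow> (\<lambda>x. \<Prod>i\<in>I. f i x) \<in> C"
proof (induction I rule: infinite_finite_induct)
  case (insert i I)
  then show ?case using mult_smooth[of "f i" "\<lambda>x. \<Prod>i\<in>I. f i x"] by (simp add: times_fun_def)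
qed auto

lemma det_smooth:
  fixes M :: "'a \<Rightarrow> real ^ 'n ^ 'n"
  assumes "\<And>i j. (\<lambda>x. M x $ i $ j) \<in> C"
  shows "(\<lambda>x. det (M x)) \<in> C"
  unfolding det_def using assms by (intro sum_smooth_pointwise scale_smooth prod_smooth) auto

text \<open>Smoothness of functions defined pointwise by frame-independent expressions is always checked by
  comparison with a globally smooth function near each point.\<close>

lemma smooth_funs_local:
  assumes "\<And>p. \<exists>W. open W \<and> p \<in> W \<and> (\<exists>h\<in>C. \<forall>q\<in>W. f q = h q)"
  shows "f \<in> C"
proof (rule smooth_funsI, rule Ck_on_local)
  fix U x k y assume c: "(U, x) \<in> A" and "y \<in> x ` U"
  then obtain p where p: "p \<in> U" "y = x p" by auto
  obtain W h where W: "open W" "p \<in> W" "h \<in> C" "\<forall>q\<in>W. f q = h q"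
    using assms[of p] by (elim exE conjE bexE)
  let ?T = "x ` (U \<inter> W)"
  have "Ck_on k ?T (h \<circ> inv_into U x)"
    by (rule Ck_on_subset[OF smooth_funsD[OF W(3) c]]) auto
  then have "Ck_on k ?T (f \<circ> inv_into U x)"
    by (rule Ck_on_cong[OF chart_image_open[OF c W(1)], rotated])
       (use W(4) chart(4)[OF c] in auto)
  then show "\<exists>T. open T \<and> y \<in> T \<and> Ck_on k T (f \<circ> inv_into U x)"
    using chart_image_open[OF c W(1)] p W(2) by blast
qed

text \<open>The bump is transported from a ball in one chart.  In any other chart it is, on the overlap,
  the Euclidean bump composed with a transition map; off the compact preimage of the closed ball,
  which is closed because the manifold is Hausdorff, it vanishes.  These two open sets cover.\<close>

lemma bump_function:
  assumes "open W" "p \<in> W"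
  obtains h where "h \<in> C" "h p \<noteq> 0" "\<And>q. q \<notin> W \<Longrightarrow> h q = 0"
proof -
  obtain U x where c: "(U, x) \<in> A" "p \<in> U" by (rule chart_at)
  note cU = chart[OF c(1)]
  have "open (x ` (U \<inter> W))" "x p \<in> x ` (U \<inter> W)"
    using chart_image_open[OF c(1) assms(1)] assms(2) c(2) by auto
  then obtain r where r: "r > 0" "cball (x p) r \<subseteq> x ` (U \<inter> W)"
    using open_contains_cball by blast
  let ?F = "\<lambda>y. flat 0 (r\<^sup>2 - (y - x p) \<bullet> (y - x p))"
  define h where "h q = (if q \<in> U then ?F (x q) else 0)" for q
  have F0: "?F y = 0" if "y \<notin> cball (x p) r" for y
  proof -
    have "r \<le> norm (y - x p)" using that by (simp add: dist_norm norm_minus_commute)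
    then have "r\<^sup>2 \<le> (norm (y - x p))\<^sup>2" using r(1) by (intro power_mono) auto
    then show ?thesis by (simp add: flat_def power2_norm_eq_inner)
  qed
  let ?K = "inv_into U x ` cball (x p) r"
  have K: "?K \<subseteq> U \<inter> W" using r(2) cU(4) by (auto simp: subset_iff)
  have "compact ?K"
    using r(2) by (intro compact_continuous_image continuous_on_subset[OF homeomorphism_cont2[OF cU(3)]]) auto
  then have clK: "closed ?K" by (rule compact_imp_closed)
  have hK: "h q = 0" if "q \<notin> ?K" for q
  proof (cases "q \<in> U")
    case True
    then have "x q \<notin> cball (x p) r" using that cU(4) by (metis imageI inv_into_f_f)
    then show ?thesis using F0 by (simp add: h_def)
  qed (simp add: h_def)
  have "h \<in> C"
  proof (rule smooth_funsI, rule Ck_on_local)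
    fix V y k z assume d: "(V, y) \<in> A" and "z \<in> y ` V"
    then obtain q where q: "q \<in> V" "z = y q" by auto
    note cV = chart[OF d]
    show "\<exists>T. open T \<and> z \<in> T \<and> Ck_on k T (h \<circ> inv_into V y)"
    proof (cases "q \<in> U")
      case True
      let ?T = "y ` (V \<inter> U)"
      have oT: "open ?T" by (rule chart_image_open[OF d cU(1)])
      have "smooth_on ?T (x \<circ> inv_into V y)"
        using atlas c(1) d unfolding smooth_atlas_def by blast
      then have t: "Ck_on k ?T (x \<circ> inv_into V y)" for k by (simp add: smooth_on_def)
      have "Ck_on k ?T (\<lambda>y'. ?F ((x \<circ> inv_into V y) y'))"
        by (rule Ck_on_compose[OF oT open_UNIV _ Ck_on_bump t]) simp
      then have "Ck_on k ?T (h \<circ> inv_into V y)"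
        by (rule Ck_on_cong[OF oT, rotated]) (use cV(4) in \<open>auto simp: h_def\<close>)
      then show ?thesis using oT q True by blast
    next
      case False
      let ?T = "y ` (V \<inter> - ?K)"
      have oT: "open ?T" by (rule chart_image_open[OF d]) (use clK in auto)
      have "Ck_on k ?T (h \<circ> inv_into V y)"
        by (rule Ck_on_cong[OF oT _ Ck_on_const[OF oT, of k 0]])
           (use cV(4) hK in auto)
      moreover have "z \<in> ?T" using q False K by auto
      ultimately show ?thesis using oT by blast
    qed
  qed
  moreover have "h p \<noteq> 0" using r(1) c(2) by (simp add: h_def flat_def)
  moreover have "h q = 0" if "q \<notin> W" for q using hK K that by blast
  ultimately show ?thesis using that by blast
qed

subsection \<open>The module of vector fields\<close>

text \<open>The defining conditions at all points, restated as identities of functions.\<close>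

lemma VF_iff:
  "X \<in> VF \<longleftrightarrow> (\<forall>f. f \<notin> C \<longrightarrow> X f = 0) \<and> (\<forall>f\<in>C. X f \<in> C) \<and>
     (\<forall>f\<in>C. \<forall>h\<in>C. X (f + h) = X f + X h) \<and>
     (\<forall>f\<in>C. \<forall>r. X (\<lambda>x. r * f x) = (\<lambda>x. r * X f x)) \<and>
     (\<forall>f\<in>C. \<forall>h\<in>C. X (f * h) = f * X h + h * X f)"
  unfolding vector_fields_def tangent_space_def mem_Collect_eq fun_eq_iff plus_fun_apply
    times_fun_apply zero_fun_apply by blast

lemma VF_nonsmooth: "X \<in> VF \<Longrightarrow> f \<notin> C \<Longrightarrow> X f = 0"
  by (simp add: VF_iff)

lemma VF_smooth: "X \<in> VF \<Longrightarrow> f \<in> C \<Longrightarrow> X f \<in> C"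
  by (simp add: VF_iff)

lemma VF_add: "X \<in> VF \<Longrightarrow> f \<in> C \<Longrightarrow> h \<in> C \<Longrightarrow> X (f + h) = X f + X h"
  by (simp add: VF_iff)

lemma VF_mult: "X \<in> VF \<Longrightarrow> f \<in> C \<Longrightarrow> h \<in> C \<Longrightarrow> X (f * h) = f * X h + h * X f"
  by (simp add: VF_iff)

lemma VF_scale: "X \<in> VF \<Longrightarrow> f \<in> C \<Longrightarrow> X (\<lambda>x. r * f x) = (\<lambda>x. r * X f x)"
  by (simp add: VF_iff)

lemma VF_zero: "X \<in> VF \<Longrightarrow> X 0 = 0"
  using VF_scale[of X 0 0] by (simp add: zero_fun_def)

lemma VF_I:
  assumes "\<And>f. f \<notin> C \<Longrightarrow> X f = 0" "\<And>f. f \<in> C \<Longrightarrow> X f \<in> C"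
    and "\<And>f h. f \<in> C \<Longrightarrow> h \<in> C \<Longrightarrow> X (f + h) = X f + X h"
    and "\<And>f r. f \<in> C \<Longrightarrow> X (\<lambda>x. r * f x) = (\<lambda>x. r * X f x)"
    and "\<And>f h. f \<in> C \<Longrightarrow> h \<in> C \<Longrightarrow> X (f * h) = f * X h + h * X f"
  shows "X \<in> VF"
  using assms by (simp add: VF_iff)

lemma zero_VF [intro, simp]: "0 \<in> VF"
  by (rule VF_I) (auto simp: zero_fun_def fun_eq_iff)

lemma add_VF [intro, simp]: "X \<in> VF \<Longrightarrow> Y \<in> VF \<Longrightarrow> X + Y \<in> VF"
  by (rule VF_I) (auto simp: VF_smooth VF_nonsmooth VF_add VF_scale VF_mult fun_eq_iff algebra_simps)

lemma act_VF [intro, simp]: "f \<in> C \<Longrightarrow> X \<in> VF \<Longrightarrow> act f X \<in> VF"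
  by (rule VF_I) (auto simp: act_def VF_smooth VF_nonsmooth VF_add VF_scale VF_mult fun_eq_iff algebra_simps)

lemma uminus_VF [intro, simp]: "X \<in> VF \<Longrightarrow> - X \<in> VF"
proof -
  have "- X = act (- 1) X" for X :: "'a vf" by (simp add: fun_eq_iff)
  then show "X \<in> VF \<Longrightarrow> - X \<in> VF" by (metis act_VF one_smooth uminus_smooth)
qed

lemma diff_VF [intro, simp]: "X \<in> VF \<Longrightarrow> Y \<in> VF \<Longrightarrow> X - Y \<in> VF"
  using add_VF[of X "- Y"] by simp

lemma sum_VF [intro]: "(\<And>i. i \<in> I \<Longrightarrow> X i \<in> VF) \<Longrightarrow> sum X I \<in> VF"
  by (induction I rule: infinite_finite_induct) auto

lemma frame_span:
  assumes "frame_at A x E" "v \<in> tangent_space A x"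
  obtains c where "\<And>f. v f = (\<Sum>i=1..7. c i * E i f x)"
  using bspec[OF assms(1)[unfolded frame_at_def, THEN conjunct2, THEN conjunct1] assms(2)] that
  by blast

lemma frame_independent:
  assumes "frame_at A x E" "\<And>f. (\<Sum>i=1..7. c i * E i f x) = 0" "i \<in> {1..7}"
  shows "c i = 0"
  using spec[OF assms(1)[unfolded frame_at_def, THEN conjunct2, THEN conjunct2], of c] assms(2,3)
  by simp

lemma VF_tangent: "X \<in> VF \<Longrightarrow> (\<lambda>f. X f x) \<in> tangent_space A x"
  by (simp add: vector_fields_def)

lemma frame_VF: "frame_at A x E \<Longrightarrow> i \<in> {1..7} \<Longrightarrow> E i \<in> VF"
  by (simp add: frame_at_def)

subsection \<open>Tensoriality\<close>

text \<open>Covector fields without a convention for arguments that are not vector fields, so that the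
  notion applies to any expression in which one vector field is varied.\<close>

definition tensorial :: "('a vf \<Rightarrow> 'a fn) \<Rightarrow> bool" where
  "tensorial \<alpha> \<longleftrightarrow> (\<forall>X\<in>VF. \<alpha> X \<in> C) \<and> (\<forall>X\<in>VF. \<forall>Y\<in>VF. \<alpha> (X + Y) = \<alpha> X + \<alpha> Y) \<and>
     (\<forall>f\<in>C. \<forall>X\<in>VF. \<alpha> (act f X) = f * \<alpha> X)"

lemma tensorialI:
  assumes "\<And>X. X \<in> VF \<Longrightarrow> \<alpha> X \<in> C" "\<And>X Y. X \<in> VF \<Longrightarrow> Y \<in> VF \<Longrightarrow> \<alpha> (X + Y) = \<alpha> X + \<alpha> Y"
    "\<And>f X. f \<in> C \<Longrightarrow> X \<in> VF \<Longrightarrow> \<alpha> (act f X) = f * \<alpha> X"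
  shows "tensorial \<alpha>"
  using assms by (simp add: tensorial_def)

lemma tensorialD:
  assumes "tensorial \<alpha>"
  shows "X \<in> VF \<Longrightarrow> \<alpha> X \<in> C" "X \<in> VF \<Longrightarrow> Y \<in> VF \<Longrightarrow> \<alpha> (X + Y) = \<alpha> X + \<alpha> Y"
    "f \<in> C \<Longrightarrow> X \<in> VF \<Longrightarrow> \<alpha> (act f X) = f * \<alpha> X"
  using assms by (simp_all add: tensorial_def)

lemma tensorial_zero:
  assumes "tensorial \<alpha>" shows "\<alpha> 0 = 0"
proof -
  have "\<alpha> (act 0 0) = 0 * \<alpha> 0" by (rule tensorialD(3)[OF assms]) auto
  moreover have "act 0 0 = (0 :: 'a vf)" by (intro ext) simp
  ultimately show ?thesis by (simp add: fun_eq_iff)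
qed

lemma tensorial_sum:
  assumes "tensorial \<alpha>" "\<And>i. i \<in> I \<Longrightarrow> f i \<in> C" "\<And>i. i \<in> I \<Longrightarrow> X i \<in> VF"
  shows "\<alpha> (\<Sum>i\<in>I. act (f i) (X i)) = (\<Sum>i\<in>I. f i * \<alpha> (X i))"
  using assms(2,3)
  by (induction I rule: infinite_finite_induct)
     (auto simp: tensorial_zero[OF assms(1)] tensorialD[OF assms(1)] sum_VF)

text \<open>The vectors \<open>(E\<^sub>1 f, \<dots>, E\<^sub>7 f)\<close> at the point form a subspace of \<open>\<real>\<^sup>7\<close> as \<open>f\<close> varies.  A nonzero vector
  orthogonal to it would be a linear relation in the frame, so the subspace contains the
  coordinate vectors.\<close>

lemma dual_functions:
  assumes "frame_at A p E" and \<iota>: "bij_betw \<iota> (UNIV :: 7 set) {1..7}"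
  obtains fs :: "7 \<Rightarrow> 'a fn" where "\<And>j. fs j \<in> C" "\<And>i j. E (\<iota> i) (fs j) p = (if i = j then 1 else 0)"
proof -
  define F :: "'a fn \<Rightarrow> real ^ 7" where "F f = (\<chi> i. E (\<iota> i) f p)" for f
  have EV: "E (\<iota> i) \<in> VF" for i
    using assms frame_VF bij_betwE by blast
  have sub: "subspace (F ` C)"
  proof (rule subspaceI)
    show "0 \<in> F ` C"
      by (rule image_eqI[of _ _ 0]) (auto simp: F_def vec_eq_iff VF_zero[OF EV])
    show "u + v \<in> F ` C" if uv: "u \<in> F ` C" "v \<in> F ` C" for u v
    proof -
      obtain f h where "f \<in> C" "h \<in> C" "u = F f" "v = F h" using uv by blast
      then have "u + v = F (f + h)" "f + h \<in> C" by (auto simp: F_def vec_eq_iff VF_add[OF EV])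
      then show ?thesis by blast
    qed
    show "r *\<^sub>R u \<in> F ` C" if u: "u \<in> F ` C" for r u
    proof -
      obtain f where f: "f \<in> C" "u = F f" using u by blast
      then have "r *\<^sub>R u = F (\<lambda>x. r * f x)"
        by (simp add: F_def vec_eq_iff VF_scale[OF EV])
      moreover have "(\<lambda>x. r * f x) \<in> C" using f(1) by (rule scale_smooth)
      ultimately show ?thesis by blast
    qed
  qed
  have "F ` C = UNIV"
  proof (rule ccontr)
    assume "F ` C \<noteq> UNIV"
    then have "dim (F ` C) \<noteq> DIM(real ^ 7)"
      using dim_eq_full[of "F ` C"] span_eq_iff[of "F ` C"] sub by metis
    then have "dim (F ` C) < DIM(real ^ 7)"
      using dim_subset_UNIV[of "F ` C"] by linarith
    then obtain c where c: "c \<noteq> 0" "\<And>y. y \<in> span (F ` C) \<Longrightarrow> orthogonal c y"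
      using orthogonal_to_subspace_exists by blast
    have "(\<Sum>i\<in>UNIV. c $ i * E (\<iota> i) f p) = 0" for f
    proof (cases "f \<in> C")
      case True
      then have "orthogonal c (F f)" by (intro c(2) span_base) auto
      then show ?thesis by (simp add: orthogonal_def inner_vec_def F_def)
    next
      case False
      then show ?thesis using VF_nonsmooth[OF EV] by simp
    qed
    then have "(\<Sum>i=1..7. c $ inv_into UNIV \<iota> i * E i f p) = 0" for f
      using \<iota> by (subst sum.reindex_bij_betw[OF \<iota>, symmetric]) (auto simp: bij_betw_def)
    then have "c $ inv_into UNIV \<iota> i = 0" if "i \<in> {1..7}" for i
      using frame_independent[where c = "\<lambda>i. c $ inv_into UNIV \<iota> i", OF assms(1) _ that] by simp
    then have "c $ i = 0" for i
      using \<iota> bij_betwE[OF \<iota>] by (metis UNIV_I bij_betw_inv_into_left)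
    then show False using c(1) by (simp add: vec_eq_iff)
  qed
  then have "\<forall>j. \<exists>f\<in>C. axis j 1 = F f" by auto
  then obtain fs where "\<And>j. fs j \<in> C" "\<And>j. axis j 1 = F (fs j)" by metis
  then show ?thesis
    by (intro that[of fs]) (auto simp: F_def vec_eq_iff axis_def)
qed

text \<open>Near the point, Cramer's rule writes a multiple of \<open>X\<close> as a combination of the frame
  with smooth coefficients, where the factor (a determinant) is 1 at the point and the
  coefficients vanish where \<open>X\<close> does; a bump function makes the identity global.\<close>

lemma tensorial_pointwise:
  assumes U: "open U" "p \<in> U" "\<And>y. y \<in> U \<Longrightarrow> frame_at A y E"
    and \<alpha>: "tensorial \<alpha>" and X: "X \<in> VF" "\<And>f. X f p = 0"
  shows "\<alpha> X p = 0"
proof -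
  obtain \<iota> where \<iota>: "bij_betw \<iota> (UNIV :: 7 set) {1..7::nat}"
    using finite_same_card_bij[of "UNIV :: 7 set" "{1..7::nat}"] by auto
  have EV: "E (\<iota> i) \<in> VF" for i using frame_VF[OF U(3)[OF U(2)]] \<iota> bij_betwE by blast
  obtain fs where fs: "\<And>j. fs j \<in> C" "\<And>i j. E (\<iota> i) (fs j) p = (if i = j then 1 else 0)"
    using dual_functions[OF U(3)[OF U(2)] \<iota>] by metis
  obtain h where h: "h \<in> C" "h p \<noteq> 0" "\<And>q. q \<notin> U \<Longrightarrow> h q = 0"
    using bump_function[OF U(1,2)] by metis
  define M :: "'a \<Rightarrow> real ^ 7 ^ 7" where "M y = (\<chi> j i. E (\<iota> i) (fs j) y)" for y
  define N :: "7 \<Rightarrow> 'a \<Rightarrow> real ^ 7 ^ 7"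
    where "N k y = (\<chi> j i. if i = k then X (fs j) y else M y $ j $ i)" for k y
  have Ms: "(\<lambda>y. M y $ j $ i) \<in> C" for i j
    using VF_smooth[OF EV fs(1)] by (simp add: M_def)
  then have dM: "(\<lambda>y. det (M y)) \<in> C" by (rule det_smooth)
  have dN: "(\<lambda>y. det (N k y)) \<in> C" for k
  proof (rule det_smooth)
    show "(\<lambda>y. N k y $ j $ i) \<in> C" for i j
      using Ms[of j i] VF_smooth[OF X(1) fs(1)] by (cases "i = k") (simp_all add: N_def)
  qed
  have cramer: "det (M y) * X f y = (\<Sum>k\<in>UNIV. det (N k y) * E (\<iota> k) f y)" if y: "y \<in> U" for y f
  proof -
    obtain c where c: "\<And>f. X f y = (\<Sum>i=1..7. c i * E i f y)"
      using frame_span[OF U(3)[OF y] VF_tangent[OF X(1)]] by metis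
    let ?c = "\<chi> k. c (\<iota> k)"
    have c': "X f y = (\<Sum>k\<in>UNIV. ?c $ k * E (\<iota> k) f y)" for f
      unfolding c by (subst sum.reindex_bij_betw[OF \<iota>, symmetric]) simp
    have "N k y = (\<chi> j i. if i = k then (M y *v ?c) $ j else M y $ j $ i)" for k
      by (simp add: N_def M_def vec_eq_iff matrix_vector_mult_def c' mult.commute)
    then have "det (N k y) = ?c $ k * det (M y)" for k
      by (simp add: cramer_lemma)
    then show ?thesis by (simp add: c' sum_distrib_left mult_ac)
  qed
  have "act (h * (\<lambda>y. det (M y))) X = (\<Sum>k\<in>UNIV. act (h * (\<lambda>y. det (N k y))) (E (\<iota> k)))"
  proof (intro ext)
    fix f y
    show "act (h * (\<lambda>y. det (M y))) X f y = (\<Sum>k\<in>UNIV. act (h * (\<lambda>y. det (N k y))) (E (\<iota> k))) f y"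
    proof (cases "y \<in> U")
      case True
      have "h y * (det (M y) * X f y) = (\<Sum>k\<in>UNIV. h y * (det (N k y) * E (\<iota> k) f y))"
        by (simp add: cramer[OF True] sum_distrib_left)
      then show ?thesis by (simp add: sum_fun_apply mult_ac)
    qed (simp add: sum_fun_apply h(3))
  qed
  then have "\<alpha> (act (h * (\<lambda>y. det (M y))) X) p
      = \<alpha> (\<Sum>k\<in>UNIV. act (h * (\<lambda>y. det (N k y))) (E (\<iota> k))) p" by simp
  then have *: "h p * det (M p) * \<alpha> X p = (\<Sum>k\<in>UNIV. h p * det (N k p) * \<alpha> (E (\<iota> k)) p)"
    using h(1) dM dN EV X(1)
    by (simp add: tensorialD(3)[OF \<alpha>] tensorial_sum[OF \<alpha>] mult_smooth sum_fun_apply)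
  have "M p = mat 1" by (simp add: M_def fs vec_eq_iff mat_def)
  moreover have "det (N k p) = 0" for k
  proof -
    have "N k p = (\<chi> j i. if i = k then (M p *v 0) $ j else M p $ j $ i)"
      by (simp add: N_def X(2) vec_eq_iff)
    then show ?thesis by (simp add: cramer_lemma)
  qed
  ultimately show ?thesis using * h(2) by simp
qed

end

section \<open>Orthonormal frames, raising indices and traces\<close>

locale riemannian_manifold = smooth_manifold A
  for A :: "'a::t2_space chart set" +
  fixes g :: "'a metric"
  assumes metric: "riemannian_metric A g"
    and local_frames: "\<And>p. \<exists>U E. open U \<and> p \<in> U \<and> (\<forall>x\<in>U. on_frame_at A g x E)"
begin

lemma covectors_iff: "\<alpha> \<in> covectors A \<longleftrightarrow> tensorial \<alpha> \<and> (\<forall>X. X \<notin> VF \<longrightarrow> \<alpha> X = 0)"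
  by (auto simp: covectors_def lin_maps_def tensorial_def)

lemma metric_covector: "X \<in> VF \<Longrightarrow> g X \<in> covectors A"
  using metric by (auto simp: riemannian_metric_def lin_maps_def)

lemma metric_tensorial: "X \<in> VF \<Longrightarrow> tensorial (g X)"
  using metric_covector covectors_iff by blast

lemma metric_sym: "X \<in> VF \<Longrightarrow> Y \<in> VF \<Longrightarrow> g X Y = g Y X"
  using metric by (simp add: riemannian_metric_def)

lemma metric_pos: "X \<in> VF \<Longrightarrow> X f p \<noteq> 0 \<Longrightarrow> g X X p > 0"
  using metric unfolding riemannian_metric_def by blast

lemma metric_smooth [intro]: "X \<in> VF \<Longrightarrow> Y \<in> VF \<Longrightarrow> g X Y \<in> C"
  using tensorialD(1)[OF metric_tensorial] .

lemma metric_add: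
  assumes "X \<in> VF" "Y \<in> VF" "Z \<in> VF"
  shows "g X (Y + Z) = g X Y + g X Z" "g (X + Y) Z = g X Z + g Y Z"
  using assms metric tensorialD(2)[OF metric_tensorial]
  by (auto simp: riemannian_metric_def lin_maps_def)

lemma metric_act:
  assumes "X \<in> VF" "Y \<in> VF" "f \<in> C"
  shows "g X (act f Y) = f * g X Y" "g (act f X) Y = f * g X Y"
  using assms metric tensorialD(3)[OF metric_tensorial]
  by (auto simp: riemannian_metric_def lin_maps_def act_def)

lemma metric_tensorial2: "Y \<in> VF \<Longrightarrow> tensorial (\<lambda>X. g X Y)"
  by (rule tensorialI) (auto simp: metric_add metric_act)

lemma metric_uminus:
  assumes "X \<in> VF" "Y \<in> VF" shows "g X (- Y) = - g X Y" "g (- X) Y = - g X Y"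
proof -
  have u: "- X = act (- 1) X" for X :: "'a vf" by (simp add: fun_eq_iff)
  have m: "(- 1 :: 'a fn) \<in> C" by (simp add: uminus_smooth)
  show "g X (- Y) = - g X Y" "g (- X) Y = - g X Y"
    by (simp_all add: u metric_act[OF assms m])
qed

lemma metric_diff:
  assumes "X \<in> VF" "Y \<in> VF" "Z \<in> VF"
  shows "g X (Y - Z) = g X Y - g X Z" "g (X - Y) Z = g X Z - g Y Z"
  using metric_add(1)[of X Y "- Z"] metric_add(2)[of X "- Y" Z] assms
  by (simp_all add: metric_uminus)

subsection \<open>Expansion in orthonormal frames\<close>

lemma on_frameD:
  assumes "on_frame_at A g p E"
  shows "frame_at A p E" "i \<in> {1..7} \<Longrightarrow> E i \<in> VF"
    "i \<in> {1..7} \<Longrightarrow> j \<in> {1..7} \<Longrightarrow> g (E i) (E j) p = (if i = j then 1 else 0)"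
  using assms by (auto simp: on_frame_at_def frame_at_def)

text \<open>Freezing the coefficients at the point gives a vector field with the same value there, to which
  linearity applies.\<close>

lemma tensorial_combination:
  assumes \<alpha>: "tensorial \<alpha>" and X: "X \<in> VF" "\<And>i. i \<in> I \<Longrightarrow> Y i \<in> VF"
    and eq: "\<And>f. X f p = (\<Sum>i\<in>I. c i * Y i f p)"
  shows "\<alpha> X p = (\<Sum>i\<in>I. c i * \<alpha> (Y i) p)"
proof -
  obtain U E where U: "open U" "p \<in> U" "\<And>x. x \<in> U \<Longrightarrow> on_frame_at A g x E"
    using local_frames by meson
  let ?Z = "\<Sum>i\<in>I. act (\<lambda>_. c i) (Y i)"
  have Z: "?Z \<in> VF" using X(2) by (intro sum_VF) auto
  have "\<alpha> (X - ?Z) p = 0"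
    by (rule tensorial_pointwise[OF U(1,2) on_frameD(1)[OF U(3)] \<alpha>])
       (use X Z eq in \<open>auto simp: sum_fun_apply\<close>)
  moreover have "\<alpha> X = \<alpha> (X - ?Z) + \<alpha> ?Z"
    using tensorialD(2)[OF \<alpha>, of "X - ?Z" ?Z] X(1) Z by simp
  ultimately show ?thesis
    using X(2) by (simp add: tensorial_sum[OF \<alpha>] sum_fun_apply)
qed

lemma frame_expansion:
  assumes E: "on_frame_at A g p E" and X: "X \<in> VF"
  shows "X f p = (\<Sum>i=1..7. g X (E i) p * E i f p)"
proof -
  obtain c where c: "\<And>f. X f p = (\<Sum>i=1..7. c i * E i f p)"
    using frame_span[OF on_frameD(1)[OF E] VF_tangent[OF X]] by metis
  have "g X (E j) p = c j" if j: "j \<in> {1..7}" for j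
  proof -
    have "g X (E j) p = (\<Sum>i=1..7. c i * g (E i) (E j) p)"
      by (rule tensorial_combination[where c = c and Y = E, OF metric_tensorial2 X]) (use c on_frameD(2)[OF E] j in auto)
    also have "\<dots> = (\<Sum>i=1..7. if i = j then c i else 0)"
      by (rule sum.cong) (use on_frameD(3)[OF E] j in auto)
    finally show ?thesis using j by simp
  qed
  then show ?thesis using c by simp
qed

lemma tensorial_expansion:
  assumes "tensorial \<alpha>" "on_frame_at A g p E" "X \<in> VF"
  shows "\<alpha> X p = (\<Sum>i=1..7. g X (E i) p * \<alpha> (E i) p)"
  by (rule tensorial_combination[OF assms(1,3)])
     (use assms on_frameD(2) frame_expansion in auto)

text \<open>The inner product of two covectors may be computed in any orthonormal frame; only this makes
  pointwise choices of frames harmless for smoothness.\<close>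

lemma frame_change:
  assumes \<alpha>: "tensorial \<alpha>" and \<beta>: "tensorial \<beta>"
    and E: "on_frame_at A g p E" and F: "on_frame_at A g p F"
  shows "(\<Sum>i=1..7. \<alpha> (E i) p * \<beta> (E i) p) = (\<Sum>i=1..7. \<alpha> (F i) p * \<beta> (F i) p)"
proof -
  note EV = on_frameD(2)[OF E] and FV = on_frameD(2)[OF F]
  have "(\<Sum>i=1..7. \<alpha> (E i) p * \<beta> (E i) p)
      = (\<Sum>i=1..7. \<Sum>j=1..7. g (E i) (F j) p * \<alpha> (F j) p * \<beta> (E i) p)"
    by (rule sum.cong) (auto simp: tensorial_expansion[OF \<alpha> F EV] sum_distrib_right)
  also have "\<dots> = (\<Sum>j=1..7. \<Sum>i=1..7. g (E i) (F j) p * \<alpha> (F j) p * \<beta> (E i) p)"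
    by (rule sum.swap)
  also have "\<dots> = (\<Sum>j=1..7. \<alpha> (F j) p * (\<Sum>i=1..7. g (F j) (E i) p * \<beta> (E i) p))"
    by (intro sum.cong refl) (auto simp: sum_distrib_left metric_sym[OF FV EV] mult_ac intro!: sum.cong)
  also have "\<dots> = (\<Sum>j=1..7. \<alpha> (F j) p * \<beta> (F j) p)"
    by (rule sum.cong) (auto simp: tensorial_expansion[OF \<beta> E FV])
  finally show ?thesis .
qed

lemma metric_nondegenerate:
  assumes X: "X \<in> VF" and Y: "Y \<in> VF" and eq: "\<And>Z. Z \<in> VF \<Longrightarrow> g Z X = g Z Y"
  shows "X = Y"
proof (rule ccontr)
  assume "X \<noteq> Y"
  then obtain f p where "(X - Y) f p \<noteq> 0" by (auto simp: fun_eq_iff)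
  then have "g (X - Y) (X - Y) p > 0" using X Y by (intro metric_pos) auto
  moreover have "g (X - Y) (X - Y) = 0"
    using X Y eq[of "X - Y"] by (simp add: metric_diff)
  ultimately show False by simp
qed

text \<open>In any orthonormal frame the vector field must be \<open>\<Sum>\<alpha>(E\<^sub>i)E\<^sub>i\<close>.  The sum does not depend on the
  frame, so frames can be chosen separately at each point, while smoothness near a point is
  seen in one frame on a neighbourhood.\<close>

lemma sharp_exists:
  assumes \<alpha>: "tensorial \<alpha>"
  obtains V where "V \<in> VF" "\<And>X. X \<in> VF \<Longrightarrow> g X V = \<alpha> X"
proof -
  have "\<exists>E. on_frame_at A g p E" for p using local_frames by meson
  then obtain F where F: "\<And>p. on_frame_at A g p (F p)" by metis
  note FV = on_frameD(2)[OF F]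
  define V where "V f p = (\<Sum>i=1..7. \<alpha> (F p i) p * F p i f p)" for f p
  have "V \<in> VF"
  proof (rule VF_I)
    show "V f = 0" if "f \<notin> C" for f
      using VF_nonsmooth[OF FV that] by (auto simp: V_def fun_eq_iff)
    show "V f \<in> C" if f: "f \<in> C" for f
    proof (rule smooth_funs_local)
      fix p
      obtain U E where U: "open U" "p \<in> U" "\<And>x. x \<in> U \<Longrightarrow> on_frame_at A g x E"
        using local_frames by meson
      have ev: "tensorial (\<lambda>X. X f)"
        by (rule tensorialI) (use f VF_smooth in \<open>auto simp: act_def\<close>)
      have "\<forall>q\<in>U. V f q = (\<Sum>i=1..7. \<alpha> (E i) * E i f) q"
        using frame_change[OF \<alpha> ev F U(3)] by (simp add: V_def sum_fun_apply)
      moreover have "(\<Sum>i=1..7. \<alpha> (E i) * E i f) \<in> C"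
        using on_frameD(2)[OF U(3)[OF U(2)]] VF_smooth[OF _ f] tensorialD(1)[OF \<alpha>]
        by (intro sum_smooth mult_smooth) auto
      ultimately show "\<exists>W. open W \<and> p \<in> W \<and> (\<exists>h\<in>C. \<forall>q\<in>W. V f q = h q)"
        using U(1,2) by blast
    qed
    show "V (f + h) = V f + V h" if "f \<in> C" "h \<in> C" for f h
      by (auto simp: V_def fun_eq_iff VF_add[OF FV that] algebra_simps sum.distrib)
    show "V (\<lambda>x. r * f x) = (\<lambda>x. r * V f x)" if "f \<in> C" for f r
      by (auto simp: V_def fun_eq_iff VF_scale[OF FV that] sum_distrib_left mult_ac)
    show "V (f * h) = f * V h + h * V f" if "f \<in> C" "h \<in> C" for f h
      by (auto simp: V_def fun_eq_iff VF_mult[OF FV that] algebra_simps sum.distrib sum_distrib_left)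
  qed
  moreover have "g X V = \<alpha> X" if X: "X \<in> VF" for X
  proof
    fix p
    have "g X V p = (\<Sum>i=1..7. \<alpha> (F p i) p * g X (F p i) p)"
      by (rule tensorial_combination[OF metric_tensorial[OF X] \<open>V \<in> VF\<close>])
         (use FV in \<open>auto simp: V_def\<close>)
    then show "g X V p = \<alpha> X p"
      by (simp add: tensorial_expansion[OF \<alpha> F X] mult.commute)
  qed
  ultimately show ?thesis using that by blast
qed

subsection \<open>Traces\<close>

lemma endosD:
  assumes "S \<in> endos A"
  shows "X \<in> VF \<Longrightarrow> S X \<in> VF" "X \<notin> VF \<Longrightarrow> S X = 0"
    "X \<in> VF \<Longrightarrow> Y \<in> VF \<Longrightarrow> S (X + Y) = S X + S Y"
    "f \<in> C \<Longrightarrow> X \<in> VF \<Longrightarrow> S (act f X) = act f (S X)"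
  using assms by (simp_all add: endos_def lin_maps_def)

lemma endosI:
  assumes "\<And>X. X \<in> VF \<Longrightarrow> S X \<in> VF" "\<And>X. X \<notin> VF \<Longrightarrow> S X = 0"
    "\<And>X Y. X \<in> VF \<Longrightarrow> Y \<in> VF \<Longrightarrow> S (X + Y) = S X + S Y"
    "\<And>f X. f \<in> C \<Longrightarrow> X \<in> VF \<Longrightarrow> S (act f X) = act f (S X)"
  shows "S \<in> endos A"
  using assms by (simp add: endos_def lin_maps_def)

lemma endos_zero:
  assumes "S \<in> endos A" shows "S 0 = 0"
proof -
  have "S (act 0 0) = act 0 (S 0)" by (rule endosD(4)[OF assms]) auto
  moreover have "act 0 X = (0 :: 'a vf)" for X by (intro ext) simp
  ultimately show ?thesis by simp
qed

lemma endos_comp: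
  assumes "S \<in> endos A" "T \<in> endos A" shows "S \<circ> T \<in> endos A"
  using endosD[OF assms(1)] endosD[OF assms(2)] endos_zero[OF assms(1)]
  by (intro endosI) (auto simp: comp_def)

lemma endos_add:
  assumes "S \<in> endos A" "T \<in> endos A" shows "S + T \<in> endos A"
  by (rule endosI) (simp_all add: endosD[OF assms(1)] endosD[OF assms(2)] fun_eq_iff algebra_simps)

lemma endos_act:
  assumes "f \<in> C" "S \<in> endos A" shows "(\<lambda>X. act f (S X)) \<in> endos A"
  by (rule endosI) (simp_all add: assms(1) endosD[OF assms(2)] fun_eq_iff algebra_simps)

lemma endo_tensorial:
  assumes "S \<in> endos A" "Y \<in> VF" shows "tensorial (\<lambda>X. g (S X) Y)"
  using assms(2) by (intro tensorialI) (auto simp: endosD[OF assms(1)] metric_add metric_act)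

text \<open>The trace is computed by matrices in arbitrary frames.  If \<open>P\<close> expresses the frame \<open>F\<close> through
  the orthonormal frame \<open>E\<close>, and \<open>Q\<close> expresses \<open>E\<close> through \<open>F\<close>, then linear independence
  of \<open>F\<close> gives \<open>QP = 1\<close>.\<close>

lemma trace_end_frame:
  assumes S: "S \<in> endos A" and E: "on_frame_at A g p E"
  shows "trace_end A S p = (\<Sum>i=1..7. g (S (E i)) (E i) p)"
  unfolding trace_end_def
proof (rule the_equality)
  note EV = on_frameD(2)[OF E]
  have "\<forall>i\<in>{1..7}. \<forall>f. S (E i) f p = (\<Sum>j=1..7. g (S (E i)) (E j) p * E j f p)"
    using frame_expansion[OF E endosD(1)[OF S EV]] by blast
  then show "\<exists>F c. frame_at A p F \<and> (\<forall>i\<in>{1..7}. \<forall>f. S (F i) f p = (\<Sum>j=1..7. c j i * F j f p)) \<and>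
      (\<Sum>i=1..7. g (S (E i)) (E i) p) = (\<Sum>i=1..7. c i i)"
    by (intro exI[of _ E] exI[of _ "\<lambda>j i. g (S (E i)) (E j) p"]) (use on_frameD(1)[OF E] in auto)
  fix t
  assume "\<exists>F c. frame_at A p F \<and> (\<forall>i\<in>{1..7}. \<forall>f. S (F i) f p = (\<Sum>j=1..7. c j i * F j f p)) \<and>
      t = (\<Sum>i=1..7. c i i)"
  then obtain F c where F: "frame_at A p F" and t: "t = (\<Sum>i=1..7. c i i)"
    and c: "\<And>i f. i \<in> {1..7} \<Longrightarrow> S (F i) f p = (\<Sum>j=1..7. c j i * F j f p)" by blast
  note FV = frame_VF[OF F]
  let ?P = "\<lambda>a j. g (F j) (E a) p"
  have "\<exists>q. \<forall>f. E a f p = (\<Sum>i=1..7. q i * F i f p)" if "a \<in> {1..7}" for a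
    using frame_span[OF F VF_tangent[OF EV[OF that]]] by metis
  then have "\<forall>a\<in>{1..7}. \<exists>q. \<forall>f. E a f p = (\<Sum>i=1..7. q i * F i f p)" by blast
  from bchoice[OF this] obtain Q
    where Q: "\<And>a f. a \<in> {1..7} \<Longrightarrow> E a f p = (\<Sum>i=1..7. Q a i * F i f p)" by blast
  have QP: "(\<Sum>a=1..7. Q a i * ?P a j) = (if i = j then 1 else 0)"
    if ij: "i \<in> {1..7}" "j \<in> {1..7}" for i j
  proof -
    have "(\<Sum>i=1..7. ((\<Sum>a=1..7. Q a i * ?P a j) - (if i = j then 1 else 0)) * F i f p) = 0" for f
    proof -
      have "F j f p = (\<Sum>a=1..7. ?P a j * E a f p)"
        by (rule frame_expansion[OF E FV[OF ij(2)]])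
      also have "\<dots> = (\<Sum>a=1..7. \<Sum>i=1..7. Q a i * ?P a j * F i f p)"
        by (rule sum.cong) (auto simp: Q sum_distrib_left mult_ac)
      also have "\<dots> = (\<Sum>i=1..7. (\<Sum>a=1..7. Q a i * ?P a j) * F i f p)"
        by (subst sum.swap) (simp add: sum_distrib_right)
      finally have *: "F j f p = (\<Sum>i=1..7. (\<Sum>a=1..7. Q a i * ?P a j) * F i f p)" .
      have "(\<Sum>i=1..7. (if i = j then 1 else 0) * F i f p) = (\<Sum>i=1..7. if i = j then F i f p else 0)"
        by (rule sum.cong) auto
      then have "(\<Sum>i=1..7. (if i = j then 1 else 0) * F i f p) = F j f p" using ij(2) by simp
      with * show ?thesis by (simp add: left_diff_distrib sum_subtractf)
    qed
    from frame_independent[OF F this ij(1)] show ?thesis by simp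
  qed
  have SE: "g (S (E a)) (E a) p = (\<Sum>i=1..7. \<Sum>j=1..7. c j i * (Q a i * ?P a j))" if a: "a \<in> {1..7}" for a
  proof -
    have "g (S (E a)) (E a) p = (\<Sum>i=1..7. Q a i * g (S (F i)) (E a) p)"
      by (rule tensorial_combination[OF endo_tensorial[OF S EV[OF a]] EV[OF a] FV Q[OF a]])
    also have "\<dots> = (\<Sum>i=1..7. Q a i * (\<Sum>j=1..7. c j i * ?P a j))"
      by (intro sum.cong refl arg_cong2[where f = "(*)"]
          tensorial_combination[OF metric_tensorial2[OF EV[OF a]] endosD(1)[OF S FV] FV c])
    finally show ?thesis by (simp add: sum_distrib_left mult_ac)
  qed
  have "(\<Sum>a=1..7. g (S (E a)) (E a) p) = (\<Sum>a=1..7. \<Sum>i=1..7. \<Sum>j=1..7. c j i * (Q a i * ?P a j))"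
    using SE by simp
  also have "\<dots> = (\<Sum>i=1..7. \<Sum>j=1..7. c j i * (\<Sum>a=1..7. Q a i * ?P a j))"
    unfolding sum_distrib_left
    by (rule trans[OF sum.swap], rule sum.cong[OF refl], rule sum.swap)
  also have "\<dots> = (\<Sum>i=1..7. \<Sum>j=1..7. if j = i then c j i else 0)"
    by (intro sum.cong refl) (subst QP; simp)
  also have "\<dots> = t" unfolding t by (intro sum.cong refl) simp
  finally show "t = (\<Sum>a=1..7. g (S (E a)) (E a) p)" by simp
qed

lemma frame_exists: obtains E where "on_frame_at A g p E"
  using local_frames by meson

lemma tau_frame:
  assumes "S \<in> endos A" "T \<in> endos A" "on_frame_at A g p E"
  shows "tau A S T p = (\<Sum>i=1..7. g (S (T (E i))) (E i) p)"
  using trace_end_frame[OF endos_comp[OF assms(1,2)] assms(3)] by (simp add: tau_def)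

lemma tau_smooth:
  assumes "S \<in> endos A" "T \<in> endos A" shows "tau A S T \<in> C"
proof (rule smooth_funs_local)
  fix p
  obtain U E where U: "open U" "p \<in> U" "\<And>x. x \<in> U \<Longrightarrow> on_frame_at A g x E"
    using local_frames by meson
  have "\<forall>q\<in>U. tau A S T q = (\<Sum>i=1..7. g (S (T (E i))) (E i)) q"
    using tau_frame[OF assms U(3)] by (simp add: sum_fun_apply)
  moreover have "(\<Sum>i=1..7. g (S (T (E i))) (E i)) \<in> C"
    using on_frameD(2)[OF U(3)[OF U(2)]]
    by (intro sum_smooth metric_smooth endosD(1)[OF assms(1)] endosD(1)[OF assms(2)]) auto
  ultimately show "\<exists>W. open W \<and> p \<in> W \<and> (\<exists>h\<in>C. \<forall>q\<in>W. tau A S T q = h q)"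
    using U(1,2) by blast
qed

lemma tau_bilinear:
  assumes S: "S \<in> endos A" "S' \<in> endos A" and T: "T \<in> endos A" and f: "f \<in> C"
  shows "tau A (S + S') T = tau A S T + tau A S' T" "tau A T (S + S') = tau A T S + tau A T S'"
    "tau A (\<lambda>X. act f (S X)) T = f * tau A S T" "tau A T (\<lambda>X. act f (S X)) = f * tau A T S"
proof -
  { fix p
    obtain E where E: "on_frame_at A g p E" by (rule frame_exists)
    note [simp] = on_frameD(2)[OF E] tau_frame[OF _ _ E] S T f endos_add endos_act
      endosD[OF S(1)] endosD[OF S(2)] endosD[OF T] metric_add metric_act
    have "tau A (S + S') T p = (tau A S T + tau A S' T) p"
      "tau A T (S + S') p = (tau A T S + tau A T S') p"
      "tau A (\<lambda>X. act f (S X)) T p = (f * tau A S T) p"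
      "tau A T (\<lambda>X. act f (S X)) p = (f * tau A T S) p"
      by (simp_all add: sum.distrib sum_distrib_left) }
  then show "tau A (S + S') T = tau A S T + tau A S' T" "tau A T (S + S') = tau A T S + tau A T S'"
    "tau A (\<lambda>X. act f (S X)) T = f * tau A S T" "tau A T (\<lambda>X. act f (S X)) = f * tau A T S"
    by (auto simp only: fun_eq_iff)
qed

text \<open>Both sides are the same double sum of products of matrix entries in an orthonormal frame.\<close>

lemma tau_commute:
  assumes S: "S \<in> endos A" and T: "T \<in> endos A" shows "tau A S T = tau A T S"
proof
  fix p
  obtain E where E: "on_frame_at A g p E" by (rule frame_exists)
  note EV = on_frameD(2)[OF E]
  have *: "tau A S T p = (\<Sum>i=1..7. \<Sum>j=1..7. g (T (E i)) (E j) p * g (S (E j)) (E i) p)"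
    if "S \<in> endos A" "T \<in> endos A" for S T
    unfolding tau_frame[OF that E]
    by (intro sum.cong refl tensorial_expansion[OF endo_tensorial[OF that(1) EV] E] endosD(1)[OF that(2)] EV)
  show "tau A S T p = tau A T S p"
    unfolding *[OF S T] *[OF T S] by (subst sum.swap) (simp add: mult.commute)
qed

text \<open>The relation between \<open>K\<close> and \<open>B\<close> means that \<open>K\<close> is \<open>B\<^sup>T - B\<close>, and skewness of \<open>R\<close> gives
  \<open>tr(R B\<^sup>T) = - tr(R B)\<close>.\<close>

lemma tau_skew:
  assumes R: "R \<in> endos A" and B: "B \<in> endos A" and K: "K \<in> endos A"
    and skew: "\<And>X Y. X \<in> VF \<Longrightarrow> Y \<in> VF \<Longrightarrow> g (R X) Y = - g X (R Y)"
    and KB: "\<And>X Y. X \<in> VF \<Longrightarrow> Y \<in> VF \<Longrightarrow> g X (K Y) = g Y (B X) - g X (B Y)"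
  shows "tau A R K p = - 2 * tau A R B p"
proof -
  obtain E where E: "on_frame_at A g p E" by (rule frame_exists)
  note EV [simp] = on_frameD(2)[OF E]
  note [simp] = endosD(1)[OF R] endosD(1)[OF B] endosD(1)[OF K]
  have "g (R (K (E i))) (E i) p = - g (B (R (E i))) (E i) p - g (R (B (E i))) (E i) p"
    if i: "i \<in> {1..7}" for i
  proof -
    have "g (R (K (E i))) (E i) = - g (R (E i)) (K (E i))"
      using i by (simp add: skew[of "K (E i)"] metric_sym[of "K (E i)"])
    also have "\<dots> = - g (E i) (B (R (E i))) + g (R (E i)) (B (E i))"
      using i by (simp add: KB)
    also have "\<dots> = - g (B (R (E i))) (E i) - g (R (B (E i))) (E i)"
      using i by (simp add: skew metric_sym[of "E i"])
    finally show ?thesis by simp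
  qed
  then have "tau A R K p = - tau A B R p - tau A R B p"
    unfolding tau_frame[OF R K E] tau_frame[OF B R E] tau_frame[OF R B E]
    by (simp add: sum_subtractf sum_negf)
  then show ?thesis by (simp add: tau_commute[OF B R])
qed

end

section \<open>Multilinear maps and raising an index of a form\<close>

context smooth_manifold begin

text \<open>Multilinearity is expressed one slot at a time, so that what is known about covector fields applies
  to each slot of a form.\<close>

definition multilinear :: "nat \<Rightarrow> 'a form \<Rightarrow> bool" where
  "multilinear k u \<longleftrightarrow> (\<forall>vs\<in>args A k. \<forall>i<k. tensorial (\<lambda>X. u (vs[i := X])))"

definition alternating :: "nat \<Rightarrow> 'a form \<Rightarrow> bool" where
  "alternating k u \<longleftrightarrow> (\<forall>vs\<in>args A k. \<forall>i<k. \<forall>j<k. i \<noteq> j \<and> vs ! i = vs ! j \<longrightarrow> u vs = 0)"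

lemma args_nth [simp]: "vs \<in> args A k \<Longrightarrow> i < k \<Longrightarrow> vs ! i \<in> VF"
  by (auto simp: args_def)

lemma args_length: "vs \<in> args A k \<Longrightarrow> length vs = k"
  by (simp add: args_def)

lemma args_update [simp]: "vs \<in> args A k \<Longrightarrow> X \<in> VF \<Longrightarrow> vs[i := X] \<in> args A k"
  using set_update_subset_insert by (fastforce simp: args_def)

lemma args_Cons [simp]: "X # vs \<in> args A (Suc k) \<longleftrightarrow> X \<in> VF \<and> vs \<in> args A k"
  by (auto simp: args_def)

lemma multilinearD: "multilinear k u \<Longrightarrow> vs \<in> args A k \<Longrightarrow> i < k \<Longrightarrow> tensorial (\<lambda>X. u (vs[i := X]))"
  by (simp add: multilinear_def)

lemma multilinear_smooth:
  assumes "multilinear k u" "vs \<in> args A k" "0 < k" shows "u vs \<in> C"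
proof -
  have "u (vs[0 := vs ! 0]) \<in> C"
    by (rule tensorialD(1)[OF multilinearD[OF assms]]) (use assms in simp)
  then show ?thesis by simp
qed

lemma Omega_multilinear: "u \<in> Omega A k \<Longrightarrow> multilinear k u"
  unfolding multilinear_def by (auto intro!: tensorialI simp: Omega_def alt_maps_def)

lemma tensorial_add: "tensorial \<alpha> \<Longrightarrow> tensorial \<beta> \<Longrightarrow> tensorial (\<lambda>X. \<alpha> X + \<beta> X)"
  by (rule tensorialI) (auto simp: tensorialD fun_eq_iff algebra_simps)

lemma tensorial_uminus: "tensorial \<alpha> \<Longrightarrow> tensorial (\<lambda>X. - \<alpha> X)"
  by (rule tensorialI) (auto simp: tensorialD fun_eq_iff)

lemma tensorial_diff: "tensorial \<alpha> \<Longrightarrow> tensorial \<beta> \<Longrightarrow> tensorial (\<lambda>X. \<alpha> X - \<beta> X)"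
  using tensorial_add[of \<alpha> "\<lambda>X. - \<beta> X"] tensorial_uminus by simp

lemma tensorial_const_zero: "tensorial (\<lambda>X. 0)"
  by (rule tensorialI) auto

lemma tensorial_sum_maps: "(\<And>i. i \<in> I \<Longrightarrow> tensorial (\<alpha> i)) \<Longrightarrow> tensorial (\<lambda>X. \<Sum>i\<in>I. \<alpha> i X)"
  by (induction I rule: infinite_finite_induct)
     (auto intro: tensorial_add tensorial_const_zero)

lemma tensorial_mult: "f \<in> C \<Longrightarrow> tensorial \<alpha> \<Longrightarrow> tensorial (\<lambda>X. f * \<alpha> X)"
  by (rule tensorialI) (auto simp: tensorialD fun_eq_iff algebra_simps)

lemma tensorial_scale: "tensorial \<alpha> \<Longrightarrow> tensorial (\<lambda>X x. r * \<alpha> X x)"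
  using tensorial_mult[OF const_smooth[of r], of \<alpha>] by (simp add: times_fun_def)

lemma tensorial_cong:
  assumes "\<And>X. X \<in> VF \<Longrightarrow> \<alpha> X = \<beta> X" "tensorial \<beta>" shows "tensorial \<alpha>"
  by (rule tensorialI) (use assms in \<open>auto simp: tensorialD\<close>)

end

context riemannian_manifold begin

text \<open>\<open>End(TY)\<close>-valued forms correspond to forms with values in bilinear maps.  The correspondence
  is pointwise the one of covectors and vectors, and it is unique because the metric is
  nondegenerate; for the same reason it inherits multilinearity and skewness.\<close>

definition bilinear_form :: "nat \<Rightarrow> ('a vf list \<Rightarrow> 'a vf \<Rightarrow> 'a vf \<Rightarrow> 'a fn) \<Rightarrow> bool" where
  "bilinear_form p \<beta> \<longleftrightarrow>
     (\<forall>vs\<in>args A p. \<forall>X\<in>VF. tensorial (\<beta> vs X) \<and> tensorial (\<lambda>Z. \<beta> vs Z X)) \<and>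
     (\<forall>X\<in>VF. \<forall>Y\<in>VF. multilinear p (\<lambda>vs. \<beta> vs X Y) \<and> alternating p (\<lambda>vs. \<beta> vs X Y))"

lemma raise_index_spec:
  assumes \<beta>: "bilinear_form p \<beta>"
  shows "raise_index A g p \<beta> \<in> Omega_End A p"
    and "\<And>vs X Y. vs \<in> args A p \<Longrightarrow> X \<in> VF \<Longrightarrow> Y \<in> VF \<Longrightarrow> g X (raise_index A g p \<beta> vs Y) = \<beta> vs X Y"
proof -
  let ?P = "\<lambda>b. b \<in> Omega_End A p \<and>
     (\<forall>vs\<in>args A p. \<forall>X\<in>VF. \<forall>Y\<in>VF. g X (b vs Y) = \<beta> vs X Y)"
  have \<beta>1: "tensorial (\<beta> vs X)" "tensorial (\<lambda>Z. \<beta> vs Z X)" if "vs \<in> args A p" "X \<in> VF" for vs X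
    using \<beta> that by (auto simp: bilinear_form_def)
  have \<beta>2: "tensorial (\<lambda>Z. \<beta> (vs[i := Z]) X Y)" if "vs \<in> args A p" "i < p" "X \<in> VF" "Y \<in> VF" for vs i X Y
    using \<beta> that by (auto simp: bilinear_form_def multilinear_def)
  have \<beta>3: "\<beta> vs X Y = 0" if "vs \<in> args A p" "i < p" "j < p" "i \<noteq> j" "vs ! i = vs ! j" "X \<in> VF" "Y \<in> VF" for vs i j X Y
  proof -
    have "alternating p (\<lambda>vs. \<beta> vs X Y)" using \<beta> that(6,7) by (simp add: bilinear_form_def)
    then show ?thesis using that(1-5) unfolding alternating_def by blast
  qed
  have "\<exists>V\<in>VF. \<forall>X\<in>VF. g X V = \<beta> vs X Y" if "vs \<in> args A p" "Y \<in> VF" for vs Y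
    using sharp_exists[OF \<beta>1(2)[OF that]] by metis
  then have ex: "\<exists>V. V \<in> VF \<and> (\<forall>X\<in>VF. g X V = \<beta> vs X Y)" if "vs \<in> args A p" "Y \<in> VF" for vs Y
    using that by blast
  define sh where "sh vs Y = (SOME V. V \<in> VF \<and> (\<forall>X\<in>VF. g X V = \<beta> vs X Y))" for vs Y
  have sh: "sh vs Y \<in> VF" and gsh: "X \<in> VF \<Longrightarrow> g X (sh vs Y) = \<beta> vs X Y"
    if "vs \<in> args A p" "Y \<in> VF" for vs X Y
    using someI_ex[OF ex[OF that]] by (simp_all add: sh_def)
  define b where "b = (\<lambda>vs Y. if vs \<in> args A p \<and> Y \<in> VF then sh vs Y else 0)"
  have bV: "b vs Y \<in> VF" for vs Y by (simp add: b_def sh)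
  have gb: "g X (b vs Y) = \<beta> vs X Y" if "vs \<in> args A p" "X \<in> VF" "Y \<in> VF" for vs X Y
    using that by (simp add: b_def gsh)
  have b0: "b vs Y = 0" if "vs \<notin> args A p \<or> Y \<notin> VF" for vs Y
    using that by (auto simp: b_def)
  have ext: "b vs = S" if "\<And>Y. Y \<notin> VF \<Longrightarrow> S Y = 0" "\<And>Y. Y \<in> VF \<Longrightarrow> S Y \<in> VF" "vs \<in> args A p"
    "\<And>X Y. X \<in> VF \<Longrightarrow> Y \<in> VF \<Longrightarrow> g X (S Y) = \<beta> vs X Y" for vs S
  proof
    fix Y
    show "b vs Y = S Y"
    proof (cases "Y \<in> VF")
      case True
      then show ?thesis by (intro metric_nondegenerate) (use that bV gb in auto)
    qed (use that b0 in auto)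
  qed
  have "b \<in> Omega_End A p"
    unfolding Omega_End_def alt_maps_def mem_Collect_eq
  proof (intro conjI ballI allI impI)
    show "b vs = 0" if "vs \<notin> args A p" for vs
      using that b0 by auto
    show "b vs \<in> endos A" if vs: "vs \<in> args A p" for vs
    proof (rule endosI)
      show "b vs (X + Y) = b vs X + b vs Y" if "X \<in> VF" "Y \<in> VF" for X Y
        by (rule metric_nondegenerate)
           (use that vs bV in \<open>auto simp: metric_add gb tensorialD(2)[OF \<beta>1(1)]\<close>)
      show "b vs (act f X) = act f (b vs X)" if "f \<in> C" "X \<in> VF" for f X
        by (rule metric_nondegenerate)
           (use that vs bV in \<open>auto simp: metric_act gb tensorialD(3)[OF \<beta>1(1)]\<close>)
    qed (use bV b0 in auto)
    fix vs i X
    assume vs: "vs \<in> args A p" "i < p" and X: "X \<in> VF"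
    show "b (vs[i := X + Y]) = b (vs[i := X]) + b (vs[i := Y])" if "Y \<in> VF" for Y
      by (rule ext) (use that vs X bV in \<open>auto simp: b0 metric_add gb tensorialD(2)[OF \<beta>2]\<close>)
    show "b (vs[i := act f X]) = (\<lambda>Y. act f (b (vs[i := X]) Y))" if "f \<in> C" for f
      by (rule ext) (use that vs X bV in \<open>auto simp: b0 metric_act gb tensorialD(3)[OF \<beta>2] fun_eq_iff\<close>)
  next
    fix vs i j
    assume "vs \<in> args A p" "i < p" "j < p" "i \<noteq> j \<and> vs ! i = vs ! j"
    then show "b vs = 0"
      by (intro ext) (auto simp: \<beta>3 tensorial_zero[OF metric_tensorial])
  qed
  with gb have "?P b" by simp
  moreover have "b' = b" if "?P b'" for b'
  proof
    fix vs
    show "b' vs = b vs"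
    proof (cases "vs \<in> args A p")
      case True
      then have S: "b' vs \<in> endos A" using that by (simp add: Omega_End_def alt_maps_def)
      show ?thesis
        by (rule ext[symmetric]) (use True that in \<open>simp_all add: endosD[OF S]\<close>)
    next
      case False
      then show ?thesis using that b0 by (auto simp: Omega_End_def alt_maps_def)
    qed
  qed
  ultimately have "?P (raise_index A g p \<beta>)"
    unfolding raise_index_def by (rule theI)
  then show "raise_index A g p \<beta> \<in> Omega_End A p"
    and "\<And>vs X Y. vs \<in> args A p \<Longrightarrow> X \<in> VF \<Longrightarrow> Y \<in> VF \<Longrightarrow> g X (raise_index A g p \<beta> vs Y) = \<beta> vs X Y"
    by blast+
qed

end

section \<open>The Levi-Civita connection\<close>

locale levi_civita_manifold = riemannian_manifold A g
  for A :: "'a::t2_space chart set" and g :: "'a metric" +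
  fixes D :: "'a connection"
  assumes levi_civita: "levi_civita A g D"
begin

lemmas levi_civita_conjuncts = levi_civita[unfolded levi_civita_def]

lemma D_VF [intro, simp]: "X \<in> VF \<Longrightarrow> Y \<in> VF \<Longrightarrow> D X Y \<in> VF"
  by (rule levi_civita_conjuncts[THEN conjunct1, rule_format])

lemma D_add1: "X \<in> VF \<Longrightarrow> X' \<in> VF \<Longrightarrow> Y \<in> VF \<Longrightarrow> D (X + X') Y = D X Y + D X' Y"
  by (rule levi_civita_conjuncts[THEN conjunct2, THEN conjunct1, rule_format])

lemma D_act1: "f \<in> C \<Longrightarrow> X \<in> VF \<Longrightarrow> Y \<in> VF \<Longrightarrow> D (act f X) Y = act f (D X Y)"
  by (rule levi_civita_conjuncts[THEN conjunct2, THEN conjunct2, THEN conjunct1, rule_format])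

lemma D_add2: "X \<in> VF \<Longrightarrow> Y \<in> VF \<Longrightarrow> Y' \<in> VF \<Longrightarrow> D X (Y + Y') = D X Y + D X Y'"
  by (rule levi_civita_conjuncts[THEN conjunct2, THEN conjunct2, THEN conjunct2, THEN conjunct1, rule_format])

lemma D_act2: "f \<in> C \<Longrightarrow> X \<in> VF \<Longrightarrow> Y \<in> VF \<Longrightarrow> D X (act f Y) = act (X f) Y + act f (D X Y)"
  by (rule levi_civita_conjuncts[THEN conjunct2, THEN conjunct2, THEN conjunct2, THEN conjunct2, THEN conjunct1, rule_format])

lemma D_metric: "X \<in> VF \<Longrightarrow> Y \<in> VF \<Longrightarrow> Z \<in> VF \<Longrightarrow> X (g Y Z) = g (D X Y) Z + g Y (D X Z)"
  by (rule levi_civita_conjuncts[THEN conjunct2, THEN conjunct2, THEN conjunct2, THEN conjunct2, THEN conjunct2, THEN conjunct1, rule_format])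

lemma D_torsion: "X \<in> VF \<Longrightarrow> Y \<in> VF \<Longrightarrow> bracket X Y = D X Y - D Y X"
  by (rule levi_civita_conjuncts[THEN conjunct2, THEN conjunct2, THEN conjunct2, THEN conjunct2, THEN conjunct2, THEN conjunct2, rule_format, symmetric])

lemma bracket_VF [intro, simp]: "X \<in> VF \<Longrightarrow> Y \<in> VF \<Longrightarrow> bracket X Y \<in> VF"
  by (simp add: D_torsion)

lemma bracket_add:
  assumes "X \<in> VF" "Y \<in> VF" "Z \<in> VF" shows "bracket X (Y + Z) = bracket X Y + bracket X Z"
  using assms by (simp add: D_torsion D_add1 D_add2)

lemma bracket_act:
  assumes "X \<in> VF" "Y \<in> VF" "f \<in> C"
  shows "bracket X (act f Y) = act (X f) Y + act f (bracket X Y)"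
  using assms by (simp add: D_torsion D_act1 D_act2 fun_eq_iff algebra_simps)

subsection \<open>Curvature\<close>

lemma curvature_VF [intro, simp]: "X \<in> VF \<Longrightarrow> Y \<in> VF \<Longrightarrow> Z \<in> VF \<Longrightarrow> curvature D X Y Z \<in> VF"
  by (simp add: curvature_def)

lemma curvature_add2:
  assumes "X \<in> VF" "Y \<in> VF" "Y' \<in> VF" "Z \<in> VF"
  shows "curvature D X (Y + Y') Z = curvature D X Y Z + curvature D X Y' Z"
  using assms by (simp add: curvature_def bracket_add D_add1 D_add2)

lemma curvature_act2:
  assumes "f \<in> C" "X \<in> VF" "Y \<in> VF" "Z \<in> VF"
  shows "curvature D X (act f Y) Z = act f (curvature D X Y Z)"
  using assms
  by (simp add: curvature_def bracket_act D_act1 D_act2 D_add1 VF_smooth fun_eq_iff algebra_simps)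

lemma curvature_add3:
  assumes "X \<in> VF" "Y \<in> VF" "Z \<in> VF" "Z' \<in> VF"
  shows "curvature D X Y (Z + Z') = curvature D X Y Z + curvature D X Y Z'"
  using assms by (simp add: curvature_def D_add2)

lemma curvature_act3:
  assumes "f \<in> C" "X \<in> VF" "Y \<in> VF" "Z \<in> VF"
  shows "curvature D X Y (act f Z) = act f (curvature D X Y Z)"
proof -
  have "X (Y f) = bracket X Y f + Y (X f)" by (simp add: bracket_def)
  then show ?thesis
    using assms
    by (simp add: curvature_def D_act2 D_add2 VF_smooth fun_eq_iff algebra_simps)
qed

text \<open>Differentiate \<open>g(Z, W)\<close> twice: the mixed terms are symmetric in \<open>X\<close> and \<open>Y\<close> and drop out of
  the commutator.\<close>

lemma curvature_skew:
  assumes [simp]: "X \<in> VF" "Y \<in> VF" "Z \<in> VF" "W \<in> VF"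
  shows "g (curvature D X Y Z) W = - g Z (curvature D X Y W)"
proof -
  have 2: "X (Y (g Z W)) = g (D X (D Y Z)) W + g (D Y Z) (D X W) + (g (D X Z) (D Y W) + g Z (D X (D Y W)))"
    if "X \<in> VF" "Y \<in> VF" for X Y
    using that by (simp add: D_metric[of X] D_metric[of Y] VF_add[of X] metric_smooth)
  have 3: "bracket X Y (g Z W)
      = g (D X (D Y Z)) W - g (D Y (D X Z)) W + (g Z (D X (D Y W)) - g Z (D Y (D X W)))"
    unfolding bracket_def 2[OF assms(1,2)] 2[OF assms(2,1)] by (simp only: algebra_simps)
  have 4: "bracket X Y (g Z W) = g (D (bracket X Y) Z) W + g Z (D (bracket X Y) W)"
    by (rule D_metric) auto
  have 5: "g (curvature D X Y Z) W
      = g (D X (D Y Z)) W - g (D Y (D X Z)) W - g (D (bracket X Y) Z) W"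
    by (simp add: curvature_def metric_diff)
  have 6: "g Z (curvature D X Y W)
      = g Z (D X (D Y W)) - g Z (D Y (D X W)) - g Z (D (bracket X Y) W)"
    by (simp add: curvature_def metric_diff)
  show ?thesis
  proof
    fix p
    show "g (curvature D X Y Z) W p = (- g Z (curvature D X Y W)) p"
      using fun_cong[OF 3, of p] fun_cong[OF 4, of p] by (simp add: 5 6)
  qed
qed

lemma iota_R_endos:
  assumes "Z \<in> VF" "vs \<in> args A 1" shows "iota_R A D Z vs \<in> endos A"
  using assms
  by (intro endosI) (auto simp: iota_R_def curvature_add3 curvature_act3)

lemma iota_R_skew:
  assumes "Z \<in> VF" "vs \<in> args A 1" "X \<in> VF" "Y \<in> VF"
  shows "g (iota_R A D Z vs X) Y = - g X (iota_R A D Z vs Y)"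
  using assms by (simp add: iota_R_def curvature_skew)

subsection \<open>Covariant derivatives of forms\<close>

lemma Omega_covD:
  assumes "m \<in> Omega_cov A p" "vs \<in> args A p"
  shows "tensorial (m vs)" "i < p \<Longrightarrow> Y \<in> VF \<Longrightarrow> tensorial (\<lambda>X. m (vs[i := X]) Y)"
    "i < p \<Longrightarrow> j < p \<Longrightarrow> i \<noteq> j \<Longrightarrow> vs ! i = vs ! j \<Longrightarrow> m vs = 0"
proof -
  have cv: "m vs \<in> covectors A" if "vs \<in> args A p" for vs
    using assms(1) that by (simp add: Omega_cov_def alt_maps_def)
  then show "tensorial (m vs)" using assms(2) covectors_iff by blast
  show "tensorial (\<lambda>X. m (vs[i := X]) Y)" if "i < p" "Y \<in> VF"
  proof (rule tensorialI)
    show "m (vs[i := X]) Y \<in> C" if "X \<in> VF" for X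
      using cv[of "vs[i := X]"] that \<open>Y \<in> VF\<close> assms(2) covectors_iff tensorialD(1) by auto
    show "m (vs[i := X + X']) Y = m (vs[i := X]) Y + m (vs[i := X']) Y" if "X \<in> VF" "X' \<in> VF" for X X'
      using assms \<open>i < p\<close> that by (simp add: Omega_cov_def alt_maps_def)
    show "m (vs[i := act f X]) Y = f * m (vs[i := X]) Y" if "f \<in> C" "X \<in> VF" for f X
      using assms \<open>i < p\<close> that by (simp add: Omega_cov_def alt_maps_def act_def)
  qed
  show "m vs = 0" if "i < p" "j < p" "i \<noteq> j" "vs ! i = vs ! j"
    using assms that unfolding Omega_cov_def alt_maps_def by blast
qed

lemma Omega_cov_swap:
  assumes m: "m \<in> Omega_cov A p" and vs: "vs \<in> args A p" and ij: "i < p" "j < p" "i \<noteq> j"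
    and X: "X \<in> VF" and Y: "Y \<in> VF" and Z: "Z \<in> VF"
  shows "m (vs[i := X, j := Y]) Z + m (vs[i := Y, j := X]) Z = 0"
proof -
  have len: "length vs = p" by (rule args_length[OF vs])
  let ?f = "\<lambda>X Y. m (vs[i := X, j := Y]) Z"
  have diag: "?f W W = 0" if "W \<in> VF" for W
    using Omega_covD(3)[OF m, of "vs[i := W, j := W]" i j] vs ij len that by simp
  have a2: "?f V (W + W') = ?f V W + ?f V W'" if "V \<in> VF" "W \<in> VF" "W' \<in> VF" for V W W'
    using tensorialD(2)[OF Omega_covD(2)[OF m _ ij(2) Z], of "vs[i := V]"] vs that by simp
  have a1: "?f (W + W') V = ?f W V + ?f W' V" if "V \<in> VF" "W \<in> VF" "W' \<in> VF" for V W W'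
    using tensorialD(2)[OF Omega_covD(2)[OF m _ ij(1) Z], of "vs[j := V]"] vs that ij
    by (simp add: list_update_swap)
  have "0 = ?f (X + Y) (X + Y)" using diag X Y by simp
  also have "\<dots> = ?f X (X + Y) + ?f Y (X + Y)" using X Y by (intro a1) auto
  also have "\<dots> = (?f X X + ?f X Y) + (?f Y X + ?f Y Y)" using X Y by (simp only: a2)
  finally show ?thesis using X Y by (simp add: diag)
qed

text \<open>The Leibniz terms cancel in the form arguments and in the value argument, and the derivative
  direction enters only through \<open>D\<close>; skewness survives because the two terms that differentiate
  the two equal arguments are exchanged by a swap.\<close>

lemma cov_bilinear_form:
  assumes m: "m \<in> Omega_cov A p"
  shows "bilinear_form p (\<lambda>vs X Y. cov D X m vs Y)"
  unfolding bilinear_form_def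
proof (intro conjI ballI)
  note T1 = tensorialD[OF Omega_covD(1)[OF m]] and T2 = tensorialD[OF Omega_covD(2)[OF m]]
  have smooth: "cov D X m vs Y \<in> C" if "vs \<in> args A p" "X \<in> VF" "Y \<in> VF" for vs X Y
    using that unfolding cov_def args_length[OF that(1)]
    by (intro diff_smooth sum_smooth VF_smooth[OF that(2)] T1(1)) auto
  { fix vs X assume vs: "vs \<in> args A p" and X: "X \<in> VF"
    note [simp] = vs X args_length[OF vs]
    have [simp]: "vs[i := D V (vs ! i)] \<in> args A p" if "i < p" "V \<in> VF" for i V
      using that by (intro args_update[OF vs] D_VF args_nth[OF vs])
    note [simp] = args_nth[OF vs]
    show "tensorial (\<lambda>Y. cov D X m vs Y)"
    proof (rule tensorialI)
      show "cov D X m vs (Y + Y') = cov D X m vs Y + cov D X m vs Y'" if "Y \<in> VF" "Y' \<in> VF" for Y Y'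
        using that by (simp add: cov_def T1 D_add2 VF_add[OF X] sum.distrib cong: sum.cong_simp)
      show "cov D X m vs (act f Y) = f * cov D X m vs Y" if "f \<in> C" "Y \<in> VF" for f Y
        using that by (simp add: cov_def T1 D_act2 VF_mult[OF X] VF_smooth[OF X] sum_distrib_left algebra_simps
            cong: sum.cong_simp)
    qed (rule smooth; simp)
    show "tensorial (\<lambda>Z. cov D Z m vs X)"
    proof (rule tensorialI)
      show "cov D (Y + Y') m vs X = cov D Y m vs X + cov D Y' m vs X" if "Y \<in> VF" "Y' \<in> VF" for Y Y'
        using that by (simp add: cov_def T1 T2 D_add1 sum.distrib cong: sum.cong_simp)
      show "cov D (act f Y) m vs X = f * cov D Y m vs X" if "f \<in> C" "Y \<in> VF" for f Y
        using that fun_cong[OF act_def[of f Y], of "m vs X"]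
        by (simp add: cov_def T1 T2 D_act1 sum_distrib_left algebra_simps
            cong: sum.cong_simp)
    qed (rule smooth; simp) }
  fix X Y assume X: "X \<in> VF" and Y: "Y \<in> VF"
  note [simp] = X Y
  show "multilinear p (\<lambda>vs. cov D X m vs Y)"
    unfolding multilinear_def
  proof (intro ballI allI impI)
    fix vs i assume vs: "vs \<in> args A p" and i: "i < p"
    note [simp] = vs args_length[OF vs] i
    \<comment> \<open>The slots other than \<open>i\<close> contribute tensorially; the derivative that falls on the coefficient
       in slot \<open>i\<close> cancels against the derivative of the value.\<close>
    let ?rest = "\<lambda>W. \<Sum>k\<in>{..<p} - {i}. m (vs[k := D X (vs ! k), i := W]) Y"
    have eq: "cov D X m (vs[i := W]) Y
        = X (m (vs[i := W]) Y) - m (vs[i := D X W]) Y - ?rest W - m (vs[i := W]) (D X Y)" for W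
    proof -
      have "(\<Sum>k<p. m (vs[i := W, k := D X (vs[i := W] ! k)]) Y)
          = m (vs[i := D X W]) Y + (\<Sum>k\<in>{..<p} - {i}. m (vs[i := W, k := D X (vs[i := W] ! k)]) Y)"
        by (subst sum.remove[of _ i]) auto
      also have "(\<Sum>k\<in>{..<p} - {i}. m (vs[i := W, k := D X (vs[i := W] ! k)]) Y) = ?rest W"
        by (rule sum.cong) (auto simp: list_update_swap)
      finally have sum: "(\<Sum>k<p. m (vs[i := W, k := D X (vs[i := W] ! k)]) Y) = m (vs[i := D X W]) Y + ?rest W" .
      show ?thesis
        unfolding cov_def length_list_update args_length[OF vs] sum by (simp only: diff_diff_eq add.assoc)
    qed
    have rest: "tensorial ?rest"
      by (rule tensorial_sum_maps, rule Omega_covD(2)[OF m])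
         (auto intro!: args_update[OF vs] D_VF args_nth[OF vs])
    show "tensorial (\<lambda>W. cov D X m (vs[i := W]) Y)"
    proof (rule tensorialI)
      show "cov D X m (vs[i := W + W']) Y = cov D X m (vs[i := W]) Y + cov D X m (vs[i := W']) Y"
        if "W \<in> VF" "W' \<in> VF" for W W'
        using that unfolding eq
        by (simp add: T2 T1 D_add2 VF_add[OF X] tensorialD(2)[OF rest])
      show "cov D X m (vs[i := act f W]) Y = f * cov D X m (vs[i := W]) Y"
        if "f \<in> C" "W \<in> VF" for f W
        using that unfolding eq
        by (simp add: T2 T1 D_act2 VF_mult[OF X] VF_smooth[OF X] tensorialD(3)[OF rest] algebra_simps)
    qed (rule smooth; simp)
  qed
  show "alternating p (\<lambda>vs. cov D X m vs Y)"
    unfolding alternating_def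
  proof (intro ballI allI impI)
    fix vs i j assume vs: "vs \<in> args A p" and ij: "i < p" "j < p" "i \<noteq> j \<and> vs ! i = vs ! j"
    note [simp] = vs args_length[OF vs]
    let ?t = "\<lambda>k. m (vs[k := D X (vs ! k)]) Y"
    have "m vs = 0" by (rule Omega_covD(3)[OF m vs ij(1,2)]) (use ij in auto)
    moreover have "(\<Sum>k<p. ?t k) = 0"
    proof -
      have 0: "?t k = 0" if "k < p" "k \<noteq> i" "k \<noteq> j" for k
        using Omega_covD(3)[OF m args_update[OF vs D_VF[OF X args_nth[OF vs that(1)]]], of i j k] ij that
        by simp
      have "(\<Sum>k<p. ?t k) = (\<Sum>k\<in>{i, j}. ?t k)"
        by (rule sum.mono_neutral_right) (use 0 ij in auto)
      also have "\<dots> = m (vs[i := D X (vs ! i), j := vs ! j]) Y + m (vs[i := vs ! i, j := D X (vs ! j)]) Y"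
      proof -
        have "i \<noteq> j" using ij by simp
        then have "vs[i := D X (vs ! i), j := vs ! j] = vs[i := D X (vs ! i)]"
          by (subst list_update_swap) simp_all
        with \<open>i \<noteq> j\<close> show ?thesis by simp
      qed
      also have "\<dots> = 0"
        using Omega_cov_swap[OF m vs ij(1,2), of "D X (vs ! i)" "vs ! i" Y] ij args_nth[OF vs ij(1)]
        by simp
      finally show ?thesis .
    qed
    ultimately show "cov D X m vs Y = 0"
      using VF_zero[OF X] by (simp add: cov_def)
  qed
qed

lemma bilinear_form_skew:
  assumes "bilinear_form p \<beta>"
  shows "bilinear_form p (\<lambda>vs X Y. \<beta> vs Y X - \<beta> vs X Y)"
  using assms unfolding bilinear_form_def multilinear_def alternating_def
  by (simp add: tensorial_diff)

lemma op_B_spec: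
  assumes "m \<in> Omega_cov A p"
  shows "op_B A g D p m \<in> Omega_End A p"
    and "vs \<in> args A p \<Longrightarrow> X \<in> VF \<Longrightarrow> Y \<in> VF \<Longrightarrow> g X (op_B A g D p m vs Y) = cov D X m vs Y"
  unfolding op_B_def using raise_index_spec[OF cov_bilinear_form[OF assms]] by auto

text \<open>Together with \<open>op_B_spec\<close> this says \<open>\<K>m = B\<^sup>T - B\<close>.\<close>

lemma op_K_spec:
  assumes "m \<in> Omega_cov A p"
  shows "op_K A g D p m \<in> Omega_End A p"
    and "vs \<in> args A p \<Longrightarrow> X \<in> VF \<Longrightarrow> Y \<in> VF \<Longrightarrow>
      g X (op_K A g D p m vs Y) = cov D Y m vs X - cov D X m vs Y"
  unfolding op_K_def
  using raise_index_spec[OF bilinear_form_skew[OF cov_bilinear_form[OF assms]]] by auto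

end

section \<open>The curvature pairing\<close>

text \<open>After a permutation, varying one slot affects only the block of arguments to which it is sent.\<close>

lemma map_list_update_permuted:
  assumes "\<sigma> permutes {..<n}" "j < n" "length vs = n" "q \<le> n"
  shows "map (\<lambda>a. vs[\<sigma> j := W] ! \<sigma> a) [p..<q] =
    (if p \<le> j \<and> j < q then (map (\<lambda>a. vs ! \<sigma> a) [p..<q])[j - p := W] else map (\<lambda>a. vs ! \<sigma> a) [p..<q])"
proof -
  have lt: "\<sigma> a < n" if "a < n" for a
    using permutes_in_image[OF assms(1)] that by auto
  have eq: "\<sigma> j = \<sigma> a \<longleftrightarrow> j = a" for a
    using permutes_inj[OF assms(1)] by (simp add: inj_eq)
  show ?thesis
    by (rule nth_equalityI) (use assms lt in \<open>auto simp: nth_list_update eq\<close>)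
qed

lemma (in smooth_manifold) args_permuted:
  assumes "\<sigma> permutes {..<n}" "vs \<in> args A n" "q \<le> n"
  shows "map (\<lambda>a. vs ! \<sigma> a) [p..<q] \<in> args A (q - p)"
  using assms permutes_in_image[OF assms(1)] by (auto simp: args_def)

context levi_civita_manifold begin

lemma Omega_EndD:
  assumes "a \<in> Omega_End A p" "vs \<in> args A p"
  shows "a vs \<in> endos A"
    and "i < p \<Longrightarrow> X \<in> VF \<Longrightarrow> Y \<in> VF \<Longrightarrow> a (vs[i := X + Y]) = a (vs[i := X]) + a (vs[i := Y])"
    and "i < p \<Longrightarrow> f \<in> C \<Longrightarrow> X \<in> VF \<Longrightarrow> a (vs[i := act f X]) = (\<lambda>Y. act f (a (vs[i := X]) Y))"
  using assms by (simp_all add: Omega_End_def alt_maps_def)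

lemma iota_R_tau_tensorial:
  assumes Z: "Z \<in> VF" and T: "T \<in> endos A"
  shows "tensorial (\<lambda>X. tau A (iota_R A D Z [X]) T)"
proof -
  have arg: "[X] \<in> args A 1" if "X \<in> VF" for X using that by (simp add: args_def)
  note R = iota_R_endos[OF Z arg]
  show ?thesis
  proof (rule tensorialI)
    show "tau A (iota_R A D Z [X]) T \<in> C" if "X \<in> VF" for X
      by (rule tau_smooth[OF R[OF that] T])
    show "tau A (iota_R A D Z [X + Y]) T = tau A (iota_R A D Z [X]) T + tau A (iota_R A D Z [Y]) T"
      if "X \<in> VF" "Y \<in> VF" for X Y
    proof -
      have "iota_R A D Z [X + Y] = iota_R A D Z [X] + iota_R A D Z [Y]"
        using that Z by (intro ext) (simp add: iota_R_def arg curvature_add2)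
      then show ?thesis using tau_bilinear(1)[OF R[OF that(1)] R[OF that(2)] T zero_smooth] by simp
    qed
    show "tau A (iota_R A D Z [act f X]) T = f * tau A (iota_R A D Z [X]) T"
      if "f \<in> C" "X \<in> VF" for f X
    proof -
      have "iota_R A D Z [act f X] = (\<lambda>Y. act f (iota_R A D Z [X] Y))"
        using that Z by (intro ext) (simp add: iota_R_def arg curvature_act2)
      then show ?thesis using tau_bilinear(3)[OF R[OF that(2)] R[OF that(2)] T that(1)] by simp
    qed
  qed
qed

lemma Omega_End_tau_tensorial:
  assumes a: "a \<in> Omega_End A p" and vs: "vs \<in> args A p" and i: "i < p" and R: "R \<in> endos A"
  shows "tensorial (\<lambda>X. tau A R (a (vs[i := X])))"
proof -
  have E: "a (vs[i := X]) \<in> endos A" if "X \<in> VF" for X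
    by (rule Omega_EndD(1)[OF a args_update[OF vs that]])
  show ?thesis
  proof (rule tensorialI)
    show "tau A R (a (vs[i := X])) \<in> C" if "X \<in> VF" for X
      by (rule tau_smooth[OF R E[OF that]])
    show "tau A R (a (vs[i := X + Y])) = tau A R (a (vs[i := X])) + tau A R (a (vs[i := Y]))"
      if "X \<in> VF" "Y \<in> VF" for X Y
      using tau_bilinear(2)[OF E[OF that(1)] E[OF that(2)] R zero_smooth]
      by (simp add: Omega_EndD(2)[OF a vs i that])
    show "tau A R (a (vs[i := act f X])) = f * tau A R (a (vs[i := X]))" if "f \<in> C" "X \<in> VF" for f X
      using tau_bilinear(4)[OF E[OF that(2)] E[OF that(2)] R that(1)]
      by (simp add: Omega_EndD(3)[OF a vs i that])
  qed
qed

text \<open>In every term of the wedge product a given slot feeds exactly one of the two factors.\<close>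

lemma wedge_multilinear:
  assumes Z: "Z \<in> VF" and a: "a \<in> Omega_End A p"
  shows "multilinear (1 + p) (wedge A (tau A) 1 p (iota_R A D Z) a)"
  unfolding multilinear_def
proof (intro ballI allI impI)
  fix vs i assume vs: "vs \<in> args A (1 + p)" and i: "i < 1 + p"
  note len = args_length[OF vs]
  let ?F = "\<lambda>\<sigma> W. tau A (iota_R A D Z (map (\<lambda>a. vs[i := W] ! \<sigma> a) [0..<1]))
    (a (map (\<lambda>a. vs[i := W] ! \<sigma> a) [1..<1 + p]))"
  have F: "tensorial (?F \<sigma>)" if \<sigma>: "\<sigma> permutes {..<1 + p}" for \<sigma>
  proof -
    obtain j where j: "j < 1 + p" "\<sigma> j = i"
      using permutes_image[OF \<sigma>] i by (metis imageE lessThan_iff)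
    have L: "map (\<lambda>a. vs ! \<sigma> a) [1..<1 + p] \<in> args A p" "map (\<lambda>a. vs ! \<sigma> a) [0..<1] \<in> args A 1"
      using args_permuted[OF \<sigma> vs, of "1 + p" 1] args_permuted[OF \<sigma> vs, of 1 0] by simp_all
    note upd = map_list_update_permuted[OF \<sigma> j(1) len, unfolded j(2)]
    show ?thesis
    proof (cases "j = 0")
      case True
      have "?F \<sigma> W = tau A (iota_R A D Z [W]) (a (map (\<lambda>a. vs ! \<sigma> a) [1..<1 + p]))" for W
      proof -
        have 1: "map (\<lambda>a. vs[i := W] ! \<sigma> a) [0..<1] = [W]"
          by (subst upd) (simp_all add: True)
        have 2: "map (\<lambda>a. vs[i := W] ! \<sigma> a) [1..<1 + p] = map (\<lambda>a. vs ! \<sigma> a) [1..<1 + p]"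
          by (subst upd) (simp_all add: True)
        show ?thesis by (simp only: 1 2)
      qed
      then show ?thesis using iota_R_tau_tensorial[OF Z Omega_EndD(1)[OF a L(1)]] by simp
    next
      case False
      have "?F \<sigma> W = tau A (iota_R A D Z (map (\<lambda>a. vs ! \<sigma> a) [0..<1]))
          (a ((map (\<lambda>a. vs ! \<sigma> a) [1..<1 + p])[j - 1 := W]))" for W
        using upd[of 1 W 0] upd[of "1 + p" W 1] False j(1) by simp
      moreover have "j - 1 < p" using False j(1) by simp
      ultimately show ?thesis
        using Omega_End_tau_tensorial[OF a L(1) _ iota_R_endos[OF Z L(2)]] by simp
    qed
  qed
  have "tensorial (\<lambda>W x. 1 / (fact 1 * fact p) *
      (\<Sum>\<sigma> | \<sigma> permutes {..<1 + p}. (\<lambda>x. of_int (sign \<sigma>) * ?F \<sigma> W x)) x)"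
    by (intro tensorial_scale tensorial_sum_maps F) simp
  then show "tensorial (\<lambda>W. wedge A (tau A) 1 p (iota_R A D Z) a (vs[i := W]))"
    by (rule tensorial_cong[rotated]) (use vs in \<open>simp add: wedge_def sum_fun_apply fun_eq_iff\<close>)
qed

lemma curv_pairing_multilinear:
  assumes "a \<in> Omega_End A p"
  shows "multilinear (p + 1) (\<lambda>vs. curv_pairing A D r p a vs Z)"
proof (cases "Z \<in> VF")
  case True
  then show ?thesis
    using wedge_multilinear[OF True assms]
    by (auto simp: multilinear_def curv_pairing_def intro!: tensorial_scale)
next
  case False
  then show ?thesis by (auto simp: multilinear_def curv_pairing_def tensorial_const_zero)
qed

lemma curv_pairing_outside: "vs \<notin> args A (p + 1) \<Longrightarrow> curv_pairing A D r p a vs Z = 0"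
  by (simp add: curv_pairing_def wedge_def fun_eq_iff)

text \<open>The wedge product is a signed sum of traces, and \<open>tau_skew\<close> applies to each of them.\<close>

lemma curv_pairing_K:
  assumes m: "m \<in> Omega_cov A p"
  shows "curv_pairing A D (- 1 / 4) p (op_K A g D p m) = - curv_pairing A D (- 1 / 2) p (op_B A g D p m)"
proof (intro ext)
  fix vs Z x
  let ?K = "op_K A g D p m" and ?B = "op_B A g D p m"
  have "wedge A (tau A) 1 p (iota_R A D Z) ?K vs x = - 2 * wedge A (tau A) 1 p (iota_R A D Z) ?B vs x"
    if Z: "Z \<in> VF" and vs: "vs \<in> args A (1 + p)"
  proof -
    have "tau A (iota_R A D Z (map (\<lambda>a. vs ! \<sigma> a) [0..<1])) (?K (map (\<lambda>a. vs ! \<sigma> a) [1..<1 + p])) x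
        = - 2 * tau A (iota_R A D Z (map (\<lambda>a. vs ! \<sigma> a) [0..<1])) (?B (map (\<lambda>a. vs ! \<sigma> a) [1..<1 + p])) x"
      if \<sigma>: "\<sigma> permutes {..<1 + p}" for \<sigma>
    proof -
      have L: "map (\<lambda>a. vs ! \<sigma> a) [1..<1 + p] \<in> args A p" "map (\<lambda>a. vs ! \<sigma> a) [0..<1] \<in> args A 1"
        using args_permuted[OF \<sigma> vs, of "1 + p" 1] args_permuted[OF \<sigma> vs, of 1 0] by simp_all
      show ?thesis
        by (rule tau_skew[OF iota_R_endos[OF Z L(2)] Omega_EndD(1)[OF op_B_spec(1)[OF m] L(1)]
              Omega_EndD(1)[OF op_K_spec(1)[OF m] L(1)] iota_R_skew[OF Z L(2)]])
           (simp_all only: op_K_spec(2)[OF m L(1)] op_B_spec(2)[OF m L(1)])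
    qed
    then show ?thesis
      using vs by (simp add: wedge_def sum_distrib_left mult_ac cong: sum.cong_simp)
  qed
  then show "curv_pairing A D (- 1 / 4) p ?K vs Z x = (- curv_pairing A D (- 1 / 2) p ?B) vs Z x"
    by (cases "vs \<in> args A (1 + p)") (simp_all add: curv_pairing_def wedge_def)
qed

end

section \<open>The inner product of forms\<close>

lemma sum_lists_Suc:
  assumes "finite S"
  shows "(\<Sum>is | length is = Suc k \<and> set is \<subseteq> S. f is)
    = (\<Sum>i\<in>S. \<Sum>is | length is = k \<and> set is \<subseteq> S. f (i # is))"
proof -
  have eq: "{is. length is = Suc k \<and> set is \<subseteq> S}
      = (\<lambda>(i, is). i # is) ` (S \<times> {is. length is = k \<and> set is \<subseteq> S})"
    by (auto simp: length_Suc_conv image_iff)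
  show ?thesis
    unfolding eq by (subst sum.reindex) (auto simp: inj_on_def sum.cartesian_product split_def)
qed

context smooth_manifold begin

lemma multilinear_Cons:
  assumes "multilinear (Suc k) u" "X \<in> VF" shows "multilinear k (\<lambda>vs. u (X # vs))"
  unfolding multilinear_def
proof (intro ballI allI impI)
  fix vs i assume "vs \<in> args A k" "i < k"
  then show "tensorial (\<lambda>Y. u (X # vs[i := Y]))"
    using multilinearD[OF assms(1), of "X # vs" "Suc i"] assms(2) by simp
qed

lemma multilinear_head:
  assumes "multilinear (Suc k) u" "vs \<in> args A k" shows "tensorial (\<lambda>X. u (X # vs))"
  using multilinearD[OF assms(1), of "0 # vs" 0] assms(2) by simp

lemma multilinear_diff: "multilinear k u \<Longrightarrow> multilinear k v \<Longrightarrow> multilinear k (u - v)"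
  by (simp add: multilinear_def tensorial_diff)

lemma multilinear_act: "f \<in> C \<Longrightarrow> multilinear k u \<Longrightarrow> multilinear k (act f u)"
  by (simp add: multilinear_def act_def tensorial_mult)

end

context riemannian_manifold begin

text \<open>The inner product of forms up to the factorial, with the frame as a parameter.\<close>

definition frame_sum :: "nat \<Rightarrow> 'a form \<Rightarrow> 'a form \<Rightarrow> (nat \<Rightarrow> 'a vf) \<Rightarrow> 'a \<Rightarrow> real" where
  "frame_sum k \<alpha> \<beta> E p =
     (\<Sum>is | length is = k \<and> set is \<subseteq> {1..7}. \<alpha> (map E is) p * \<beta> (map E is) p)"

lemma frame_sum_Suc:
  "frame_sum (Suc k) \<alpha> \<beta> E p = (\<Sum>i=1..7. frame_sum k (\<lambda>vs. \<alpha> (E i # vs)) (\<lambda>vs. \<beta> (E i # vs)) E p)"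
  unfolding frame_sum_def by (subst sum_lists_Suc) simp_all

lemma frame_sum_0: "frame_sum 0 \<alpha> \<beta> E p = \<alpha> [] p * \<beta> [] p"
proof -
  have "{is. length is = 0 \<and> set is \<subseteq> {1..7::nat}} = {[]}" by auto
  then show ?thesis by (simp add: frame_sum_def)
qed

lemma frame_args: "on_frame_at A g p E \<Longrightarrow> set is \<subseteq> {1..7} \<Longrightarrow> map E is \<in> args A (length is)"
  using on_frameD(2) by (fastforce simp: args_def)

text \<open>Exchange the frame in one argument after the other, each time by \<open>frame_change\<close>.\<close>

lemma frame_sum_change:
  assumes E: "on_frame_at A g p E" and F: "on_frame_at A g p F"
    and "multilinear k \<alpha>" "multilinear k \<beta>"
  shows "frame_sum k \<alpha> \<beta> E p = frame_sum k \<alpha> \<beta> F p"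
  using assms(3,4)
proof (induction k arbitrary: \<alpha> \<beta>)
  case 0
  show ?case by (simp add: frame_sum_0)
next
  case (Suc k)
  let ?L = "{is. length is = k \<and> set is \<subseteq> {1..7::nat}}"
  have "frame_sum (Suc k) \<alpha> \<beta> E p = (\<Sum>i=1..7. frame_sum k (\<lambda>vs. \<alpha> (E i # vs)) (\<lambda>vs. \<beta> (E i # vs)) F p)"
    unfolding frame_sum_Suc
    by (intro sum.cong refl Suc.IH multilinear_Cons Suc.prems on_frameD(2)[OF E])
  also have "\<dots> = (\<Sum>is\<in>?L. \<Sum>i=1..7. \<alpha> (E i # map F is) p * \<beta> (E i # map F is) p)"
    unfolding frame_sum_def by (rule sum.swap)
  also have "\<dots> = (\<Sum>is\<in>?L. \<Sum>i=1..7. \<alpha> (F i # map F is) p * \<beta> (F i # map F is) p)"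
    by (intro sum.cong[OF refl] frame_change[OF multilinear_head[OF Suc.prems(1)]
          multilinear_head[OF Suc.prems(2)] E F]) (use frame_args[OF F] in auto)
  also have "\<dots> = frame_sum (Suc k) \<alpha> \<beta> F p"
    unfolding frame_sum_Suc unfolding frame_sum_def by (rule sum.swap)
  finally show ?case .
qed

lemma form_inner_frame:
  assumes "multilinear k \<alpha>" "multilinear k \<beta>" "on_frame_at A g p E"
  shows "form_inner A g k \<alpha> \<beta> p = frame_sum k \<alpha> \<beta> E p / fact k"
proof -
  have "on_frame_at A g p (SOME E. on_frame_at A g p E)"
    by (rule someI[of "on_frame_at A g p", OF assms(3)])
  then show ?thesis
    using frame_sum_change[OF _ assms(3) assms(1,2)]
    unfolding form_inner_def Let_def frame_sum_def by simp
qed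

lemma form_inner_smooth:
  assumes "multilinear k \<alpha>" "multilinear k \<beta>" "0 < k"
  shows "form_inner A g k \<alpha> \<beta> \<in> C"
proof (rule smooth_funs_local)
  fix p
  obtain U E where U: "open U" "p \<in> U" "\<And>x. x \<in> U \<Longrightarrow> on_frame_at A g x E"
    using local_frames by meson
  let ?h = "\<lambda>x. 1 / fact k *
    (\<Sum>is | length is = k \<and> set is \<subseteq> {1..7}. \<alpha> (map E is) * \<beta> (map E is)) x"
  have "\<alpha> (map E is) * \<beta> (map E is) \<in> C" if "length is = k" "set is \<subseteq> {1..7}" for "is"
    using frame_args[OF U(3)[OF U(2)] that(2)] that(1)
    by (intro mult_smooth multilinear_smooth[OF assms(1) _ assms(3)]
        multilinear_smooth[OF assms(2) _ assms(3)]) simp_all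
  then have "(\<Sum>is | length is = k \<and> set is \<subseteq> {1..7}. \<alpha> (map E is) * \<beta> (map E is)) \<in> C"
    by (intro sum_smooth) auto
  then have "?h \<in> C" by (rule scale_smooth)
  moreover have "\<forall>q\<in>U. form_inner A g k \<alpha> \<beta> q = ?h q"
    using form_inner_frame[OF assms(1,2) U(3)] by (simp add: frame_sum_def sum_fun_apply)
  ultimately show "\<exists>W. open W \<and> p \<in> W \<and> (\<exists>h\<in>C. \<forall>q\<in>W. form_inner A g k \<alpha> \<beta> q = h q)"
    using U(1,2) by (intro exI[of _ U] conjI bexI[of _ ?h])
qed

lemma form_inner_diff:
  "form_inner A g k (\<alpha> - \<alpha>') \<beta> = form_inner A g k \<alpha> \<beta> - form_inner A g k \<alpha>' \<beta>"
  by (simp add: form_inner_def Let_def fun_eq_iff left_diff_distrib sum_subtractf diff_divide_distrib)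

lemma form_inner_uminus: "form_inner A g k (- \<alpha>) \<beta> = - form_inner A g k \<alpha> \<beta>"
  by (simp add: form_inner_def Let_def fun_eq_iff sum_negf)

lemma form_inner_sym: "form_inner A g k \<alpha> \<beta> = form_inner A g k \<beta> \<alpha>"
  by (simp add: form_inner_def mult.commute)

lemma multilinear_zero_on_frame:
  assumes "on_frame_at A g p E" "multilinear k u"
    and "\<And>is. length is = k \<Longrightarrow> set is \<subseteq> {1..7} \<Longrightarrow> u (map E is) p = 0"
    and "vs \<in> args A k"
  shows "u vs p = 0"
  using assms(2-)
proof (induction k arbitrary: u vs)
  case 0
  then show ?case by (auto simp: args_def)
next
  case (Suc k)
  obtain X ws where vs: "vs = X # ws" "X \<in> VF" "ws \<in> args A k"
    using Suc.prems(3) by (cases vs) (auto simp: args_def)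
  have "u (E i # ws) p = 0" if i: "i \<in> {1..7}" for i
    using multilinear_Cons[OF Suc.prems(1) on_frameD(2)[OF assms(1) i]] vs(3)
    by (intro Suc.IH[of "\<lambda>ws. u (E i # ws)" ws] allI impI)
       (use i Suc.prems(2)[of "i # _"] in auto)
  then show ?case
    using tensorial_expansion[OF multilinear_head[OF Suc.prems(1) vs(3)] assms(1) vs(2)]
    by (simp add: vs(1))
qed

lemma form_inner_definite:
  assumes u: "multilinear k u" "\<And>vs. vs \<notin> args A k \<Longrightarrow> u vs = 0" and "form_inner A g k u u = 0"
  shows "u = 0"
proof (intro ext)
  fix vs p
  obtain E where E: "on_frame_at A g p E" by (rule frame_exists)
  let ?L = "{is. length is = k \<and> set is \<subseteq> {1..7::nat}}"
  have "finite ?L" using finite_lists_length_eq[of "{1..7::nat}" k] by (simp add: conj_commute)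
  moreover have "(\<Sum>is\<in>?L. u (map E is) p * u (map E is) p) = 0"
    using form_inner_frame[OF u(1) u(1) E] assms(3) by (simp add: frame_sum_def)
  ultimately have "u (map E is) p = 0" if "is \<in> ?L" for "is"
    using that by (subst (asm) sum_nonneg_eq_0_iff) auto
  then show "u vs p = 0 vs p"
    using multilinear_zero_on_frame[OF E u(1)] u(2) by (cases "vs \<in> args A k") auto
qed

lemma bilinear_eq_on_frame:
  assumes E: "on_frame_at A g p E"
    and \<beta>: "\<And>Y. Y \<in> VF \<Longrightarrow> tensorial (\<lambda>X. \<beta> X Y)" "\<And>X. X \<in> VF \<Longrightarrow> tensorial (\<beta> X)"
    and eq: "\<And>i j. i \<in> {1..7} \<Longrightarrow> j \<in> {1..7} \<Longrightarrow> \<beta> (E i) (E j) p = r * g (E i) (E j) p"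
    and X: "X \<in> VF" and Y: "Y \<in> VF"
  shows "\<beta> X Y p = r * g X Y p"
proof -
  note EV = on_frameD(2)[OF E]
  have "\<beta> (E i) Y p = r * g (E i) Y p" if i: "i \<in> {1..7}" for i
    using tensorial_expansion[OF \<beta>(2)[OF EV[OF i]] E Y]
      tensorial_expansion[OF metric_tensorial[OF EV[OF i]] E Y] eq[OF i]
    by (simp add: sum_distrib_left mult_ac cong: sum.cong_simp)
  then show ?thesis
    using tensorial_expansion[OF \<beta>(1)[OF Y] E X] tensorial_expansion[OF metric_tensorial2[OF Y] E X]
    by (simp add: sum_distrib_left mult_ac cong: sum.cong_simp)
qed

end

section \<open>Contractions of the associative form\<close>

lemma sum_permutations_3:
  "(\<Sum>\<sigma> | \<sigma> permutes {..<3::nat}. of_int (sign \<sigma>) * (\<Prod>n<3. M n (\<sigma> n) :: real)) =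
     M 0 0 * (M 1 1 * M 2 2 - M 1 2 * M 2 1) - M 0 1 * (M 1 0 * M 2 2 - M 1 2 * M 2 0)
     + M 0 2 * (M 1 0 * M 2 1 - M 1 1 * M 2 0)"
proof -
  have f: "{..<3::nat} = {0, 1, 2}" by auto
  have 12: "finite {1::nat, 2}" "0 \<notin> {1::nat, 2}" by auto
  have 2: "finite {2::nat}" "1 \<notin> {2::nat}" by auto
  show ?thesis
    unfolding f sum_over_permutations_insert[OF 12] sum_over_permutations_insert[OF 2] permutes_sing
    by (simp add: sign_swap_id permutation_swap_id sign_compose sign_id transpose_def algebra_simps)
qed

text \<open>The components of \<open>\<phi>\<close> in a \<open>G\<^sub>2\<close> frame are integers; they are written as functions of integer
  indices so that their contractions can be evaluated.\<close>

definition kronecker :: "int \<Rightarrow> int \<Rightarrow> int" where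
  "kronecker i j = (if i = j then 1 else 0)"

text \<open>The component of \<open>e\<^sup>a\<^sup>b\<^sup>c\<close> on the basis vectors with indices \<open>i\<close>, \<open>j\<close>, \<open>k\<close>: a determinant of
  Kronecker symbols.\<close>

definition coframe_component :: "int \<Rightarrow> int \<Rightarrow> int \<Rightarrow> int \<Rightarrow> int \<Rightarrow> int \<Rightarrow> int" where
  "coframe_component a b c i j k = kronecker a i * (kronecker b j * kronecker c k - kronecker b k * kronecker c j)
     - kronecker a j * (kronecker b i * kronecker c k - kronecker b k * kronecker c i)
     + kronecker a k * (kronecker b i * kronecker c j - kronecker b j * kronecker c i)"

definition phi_component :: "int \<Rightarrow> int \<Rightarrow> int \<Rightarrow> int" where
  "phi_component i j k = coframe_component 1 2 3 i j k + coframe_component 1 4 5 i j k + coframe_component 1 6 7 i j k + coframe_component 2 4 6 i j k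
     - coframe_component 2 5 7 i j k - coframe_component 3 4 7 i j k - coframe_component 3 5 6 i j k"

lemma sum_1_7: "(\<Sum>i=1..7::nat. f (int i)) = (\<Sum>i\<leftarrow>[1..7]. f i)"
proof -
  have "(\<Sum>i=1..7::nat. f (int i)) = (\<Sum>i=1..7::int. f i)"
    by (rule sum.reindex_bij_witness[of _ nat int]) auto
  also have "\<dots> = (\<Sum>i\<leftarrow>[1..7]. f i)"
    using sum_list_distinct_conv_sum_set[OF distinct_upto, of f 1 7] by (simp only: set_upto)
  finally show ?thesis .
qed

text \<open>The classical contraction of \<open>\<phi>\<close> with itself in two indices, checked by evaluating the 49 sums.\<close>

lemma phi_component_contraction:
  assumes "a \<in> {1..7}" "b \<in> {1..7}"
  shows "(\<Sum>j=1..7::nat. \<Sum>k=1..7::nat. phi_component a (int j) (int k) * phi_component b (int j) (int k)) = 6 * kronecker a b"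
proof -
  have "\<forall>a\<in>set [1..7]. \<forall>b\<in>set [1..7].
      (\<Sum>j\<leftarrow>[1..7]. \<Sum>k\<leftarrow>[1..7]. phi_component a j k * phi_component b j k) = 6 * kronecker a b"
    by code_simp
  moreover have "(\<Sum>j=1..7::nat. \<Sum>k=1..7::nat. phi_component a (int j) (int k) * phi_component b (int j) (int k))
      = (\<Sum>j\<leftarrow>[1..7]. \<Sum>k\<leftarrow>[1..7]. phi_component a j k * phi_component b j k)"
  proof -
    have "(\<Sum>k=1..7::nat. phi_component a (int j) (int k) * phi_component b (int j) (int k))
        = (\<Sum>k\<leftarrow>[1..7]. phi_component a (int j) k * phi_component b (int j) k)" for j :: nat
      by (rule sum_1_7[where f = "\<lambda>k. phi_component a (int j) k * phi_component b (int j) k"])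
    then show ?thesis
      by (simp only: sum_1_7[where f = "\<lambda>j. \<Sum>k\<leftarrow>[1..7]. phi_component a j k * phi_component b j k"])
  qed
  ultimately show ?thesis using assms by simp
qed

section \<open>Projections onto the canonical subbundles\<close>

locale G2_manifold = riemannian_manifold A g
  for A :: "'a::t2_space chart set" and g :: "'a metric" +
  fixes \<phi> :: "'a form"
  assumes phi_Omega: "\<phi> \<in> Omega A 3"
    and phi_frame: "\<And>p. \<exists>E. on_frame_at A g p E \<and> (\<forall>vs\<in>args A 3. \<phi> vs p = phi_std (\<lambda>i. g (E i)) vs p)"
begin

lemma phi_multilinear: "multilinear 3 \<phi>"
  by (rule Omega_multilinear[OF phi_Omega])

lemma phi_outside: "vs \<notin> args A 3 \<Longrightarrow> \<phi> vs = 0"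
  using phi_Omega by (simp add: Omega_def alt_maps_def)

lemma iota_phi_multilinear: "X \<in> VF \<Longrightarrow> multilinear 2 (\<lambda>vs. \<phi> (X # vs))"
  using multilinear_Cons[of 2 \<phi> X] phi_multilinear by simp

lemma phi_tensorial: "vs \<in> args A 2 \<Longrightarrow> tensorial (\<lambda>X. \<phi> (X # vs))"
  using multilinear_head[of 2 \<phi> vs] phi_multilinear by simp

lemma e_form_3_frame:
  assumes E: "on_frame_at A g p E" and "{a, b, c, i, j, k} \<subseteq> {1..7}"
  shows "e_form (\<lambda>i. g (E i)) [a, b, c] [E i, E j, E k] p
    = of_int (coframe_component (int a) (int b) (int c) (int i) (int j) (int k))"
proof -
  have g: "g (E l) (E m) p = of_int (kronecker (int l) (int m))" if "l \<in> {1..7}" "m \<in> {1..7}" for l m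
    using on_frameD(3)[OF E that] by (simp add: kronecker_def)
  have "e_form (\<lambda>i. g (E i)) [a, b, c] [E i, E j, E k] p
      = (\<Sum>\<sigma> | \<sigma> permutes {..<3::nat}. of_int (sign \<sigma>) * (\<Prod>n<3. g (E ([a, b, c] ! n)) ([E i, E j, E k] ! \<sigma> n) p))"
    by (simp add: e_form_def numeral_3_eq_3)
  then show ?thesis
    unfolding sum_permutations_3[where M = "\<lambda>n m. g (E ([a, b, c] ! n)) ([E i, E j, E k] ! m) p"]
    using assms(2) by (simp add: g coframe_component_def)
qed

lemma phi_G2_frame:
  obtains E where "on_frame_at A g p E"
    and "\<And>i j k. {i, j, k} \<subseteq> {1..7} \<Longrightarrow> \<phi> [E i, E j, E k] p = of_int (phi_component (int i) (int j) (int k))"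
proof -
  obtain E where E: "on_frame_at A g p E" "\<forall>vs\<in>args A 3. \<phi> vs p = phi_std (\<lambda>i. g (E i)) vs p"
    using phi_frame by blast
  have "\<phi> [E i, E j, E k] p = of_int (phi_component (int i) (int j) (int k))" if "{i, j, k} \<subseteq> {1..7}" for i j k
  proof -
    have "[E i, E j, E k] \<in> args A 3"
      using that on_frameD(2)[OF E(1)] by (auto simp: args_def)
    then have "\<phi> [E i, E j, E k] p = phi_std (\<lambda>i. g (E i)) [E i, E j, E k] p"
      using E(2) by blast
    also have "\<dots> = of_int (phi_component (int i) (int j) (int k))"
      using that by (simp add: phi_std_def e_form_3_frame[OF E(1)] phi_component_def)
    finally show ?thesis .
  qed
  with E(1) show ?thesis using that by blast
qed

text \<open>The covector whose dual vector, divided by 3, determines the projection of \<open>u\<close> to \<open>\<Lambda>\<^sup>2\<^sub>7\<close>.\<close>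

lemma inner_iota_tensorial:
  assumes u: "multilinear 2 u"
  shows "tensorial (\<lambda>X. form_inner A g 2 u (\<lambda>vs. \<phi> (X # vs)))"
proof (rule tensorialI)
  show "form_inner A g 2 u (\<lambda>vs. \<phi> (X # vs)) \<in> C" if "X \<in> VF" for X
    by (rule form_inner_smooth[OF u iota_phi_multilinear[OF that]]) simp
  have eq: "form_inner A g 2 u (\<lambda>vs. \<phi> (X # vs)) p
      = (\<Sum>is | length is = 2 \<and> set is \<subseteq> {1..7}. u (map E is) p * \<phi> (X # map E is) p) / 2"
    if "X \<in> VF" "on_frame_at A g p E" for X p E
    using form_inner_frame[OF u iota_phi_multilinear[OF that(1)] that(2)] by (simp add: frame_sum_def)
  have args: "map E is \<in> args A 2" if "on_frame_at A g p E" "is \<in> {is. length is = 2 \<and> set is \<subseteq> {1..7}}" for p E "is"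
    using frame_args[OF that(1)] that(2) by force
  show "form_inner A g 2 u (\<lambda>vs. \<phi> ((X + Y) # vs))
      = form_inner A g 2 u (\<lambda>vs. \<phi> (X # vs)) + form_inner A g 2 u (\<lambda>vs. \<phi> (Y # vs))"
    if "X \<in> VF" "Y \<in> VF" for X Y
  proof
    fix p
    obtain E where E: "on_frame_at A g p E" by (rule frame_exists)
    have "\<phi> ((X + Y) # map E is) = \<phi> (X # map E is) + \<phi> (Y # map E is)"
      if "is \<in> {is. length is = 2 \<and> set is \<subseteq> {1..7}}" for "is"
      using tensorialD(2)[OF phi_tensorial[OF args[OF E that]]] \<open>X \<in> VF\<close> \<open>Y \<in> VF\<close> by blast
    then show "form_inner A g 2 u (\<lambda>vs. \<phi> ((X + Y) # vs)) p
      = (form_inner A g 2 u (\<lambda>vs. \<phi> (X # vs)) + form_inner A g 2 u (\<lambda>vs. \<phi> (Y # vs))) p"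
      using that by (simp add: eq[OF _ E] distrib_left sum.distrib add_divide_distrib cong: sum.cong_simp)
  qed
  show "form_inner A g 2 u (\<lambda>vs. \<phi> (act f X # vs)) = f * form_inner A g 2 u (\<lambda>vs. \<phi> (X # vs))"
    if "f \<in> C" "X \<in> VF" for f X
  proof
    fix p
    obtain E where E: "on_frame_at A g p E" by (rule frame_exists)
    have "\<phi> (act f X # map E is) = f * \<phi> (X # map E is)"
      if "is \<in> {is. length is = 2 \<and> set is \<subseteq> {1..7}}" for "is"
      using tensorialD(3)[OF phi_tensorial[OF args[OF E that]]] \<open>f \<in> C\<close> \<open>X \<in> VF\<close> by blast
    then show "form_inner A g 2 u (\<lambda>vs. \<phi> (act f X # vs)) p = (f * form_inner A g 2 u (\<lambda>vs. \<phi> (X # vs))) p"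
      using that by (simp add: eq[OF _ E] sum_distrib_left mult_ac cong: sum.cong_simp)
  qed
qed

text \<open>Both sides are bilinear over the smooth functions, so it suffices to compare them on a \<open>G\<^sub>2\<close> frame;
  the factor is the 6 of the contraction over \<open>2!\<close>.\<close>

lemma inner_iota_phi:
  assumes X: "X \<in> VF" and Y: "Y \<in> VF"
  shows "form_inner A g 2 (\<lambda>vs. \<phi> (X # vs)) (\<lambda>vs. \<phi> (Y # vs)) p = 3 * g X Y p"
proof -
  obtain E where E: "on_frame_at A g p E"
    and phi: "\<And>i j k. {i, j, k} \<subseteq> {1..7} \<Longrightarrow> \<phi> [E i, E j, E k] p = of_int (phi_component (int i) (int j) (int k))"
    using phi_G2_frame[of p] by blast
  let ?\<beta> = "\<lambda>X Y. form_inner A g 2 (\<lambda>vs. \<phi> (X # vs)) (\<lambda>vs. \<phi> (Y # vs))"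
  have t: "tensorial (?\<beta> X)" if "X \<in> VF" for X
    by (rule inner_iota_tensorial[OF iota_phi_multilinear[OF that]])
  have "?\<beta> X Y p = 3 * g X Y p"
  proof (rule bilinear_eq_on_frame[OF E _ t _ X Y])
    show "tensorial (\<lambda>X. ?\<beta> X Y)" if "Y \<in> VF" for Y
      using t[OF that] by (subst form_inner_sym)
    fix a b :: nat assume ab: "a \<in> {1..7}" "b \<in> {1..7}"
    note EV = on_frameD(2)[OF E]
    have "frame_sum 2 (\<lambda>vs. \<phi> (E a # vs)) (\<lambda>vs. \<phi> (E b # vs)) E p
        = (\<Sum>j=1..7. \<Sum>k=1..7. \<phi> [E a, E j, E k] p * \<phi> [E b, E j, E k] p)"
      by (simp add: numeral_2_eq_2 frame_sum_Suc frame_sum_0)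
    also have "\<dots> = of_int (\<Sum>j=1..7::nat. \<Sum>k=1..7::nat. phi_component (int a) (int j) (int k) * phi_component (int b) (int j) (int k))"
      unfolding of_int_sum of_int_mult by (intro sum.cong refl) (use ab in \<open>simp add: phi\<close>)
    also have "\<dots> = 6 * g (E a) (E b) p"
      using ab on_frameD(3)[OF E ab] by (subst phi_component_contraction) (auto simp: kronecker_def)
    finally show "?\<beta> (E a) (E b) p = 3 * g (E a) (E b) p"
      using form_inner_frame[OF iota_phi_multilinear[OF EV[OF ab(1)]] iota_phi_multilinear[OF EV[OF ab(2)]] E]
      by simp
  qed
  then show ?thesis .
qed

text \<open>Trace the contraction once more: \<open>7 \<cdot> 6 / 3!\<close>.\<close>

lemma inner_phi_phi: "form_inner A g 3 \<phi> \<phi> p = 7"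
proof -
  obtain E where E: "on_frame_at A g p E"
    and phi: "\<And>i j k. {i, j, k} \<subseteq> {1..7} \<Longrightarrow> \<phi> [E i, E j, E k] p = of_int (phi_component (int i) (int j) (int k))"
    using phi_G2_frame[of p] by blast
  have "frame_sum 3 \<phi> \<phi> E p = (\<Sum>i=1..7. \<Sum>j=1..7. \<Sum>k=1..7. \<phi> [E i, E j, E k] p * \<phi> [E i, E j, E k] p)"
    by (simp add: numeral_3_eq_3 frame_sum_Suc frame_sum_0)
  also have "\<dots> = (\<Sum>i=1..7::nat. of_int (\<Sum>j=1..7::nat. \<Sum>k=1..7::nat. phi_component (int i) (int j) (int k) * phi_component (int i) (int j) (int k)))"
    unfolding of_int_sum of_int_mult by (intro sum.cong refl) (simp add: phi)
  also have "\<dots> = (\<Sum>i=1..7::nat. 6)"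
    by (intro sum.cong refl) (subst phi_component_contraction; simp add: kronecker_def)
  finally show ?thesis
    using form_inner_frame[OF phi_multilinear phi_multilinear E] by (simp add: fact_numeral)
qed

lemma Omega_1_iff: "u \<in> Omega A 1 \<longleftrightarrow> multilinear 1 u \<and> (\<forall>vs. vs \<notin> args A 1 \<longrightarrow> u vs = 0)"
proof
  assume "u \<in> Omega A 1"
  then show "multilinear 1 u \<and> (\<forall>vs. vs \<notin> args A 1 \<longrightarrow> u vs = 0)"
    using Omega_multilinear by (simp add: Omega_def alt_maps_def)
next
  assume u: "multilinear 1 u \<and> (\<forall>vs. vs \<notin> args A 1 \<longrightarrow> u vs = 0)"
  then have "tensorial (\<lambda>X. u (vs[0 := X]))" if "vs \<in> args A 1" for vs
    using that by (simp add: multilinear_def)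
  note t = tensorialD[OF this]
  show "u \<in> Omega A 1"
    unfolding Omega_def alt_maps_def mem_Collect_eq
    using u t(2,3) multilinear_smooth[of 1 u] by auto
qed

lemma Lambda_can_multilinear:
  assumes "\<eta> \<in> Lambda_can A \<phi> k" "1 \<le> k"
  shows "multilinear k \<eta>" "vs \<notin> args A k \<Longrightarrow> \<eta> vs = 0"
proof -
  consider "k = 1" "\<eta> \<in> Omega A 1" | X where "k = 2" "X \<in> VF" "\<eta> = (\<lambda>vs. \<phi> (X # vs))"
    | f where "k = 3" "f \<in> C" "\<eta> = act f \<phi>" | "\<eta> = 0"
    using assms by (auto simp: Lambda_can_def split: if_splits)
  then have "multilinear k \<eta> \<and> (\<forall>vs. vs \<notin> args A k \<longrightarrow> \<eta> vs = 0)"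
  proof cases
    case 1
    then show ?thesis using Omega_1_iff by simp
  next
    case 2
    then show ?thesis using iota_phi_multilinear phi_outside by (auto simp: numeral_3_eq_3 numeral_2_eq_2)
  next
    case 3
    then show ?thesis using multilinear_act[OF _ phi_multilinear] phi_outside by (auto simp: act_def)
  next
    case 4
    then show ?thesis by (simp add: multilinear_def tensorial_const_zero)
  qed
  then show "multilinear k \<eta>" "vs \<notin> args A k \<Longrightarrow> \<eta> vs = 0" by auto
qed

lemma Lambda_can_diff:
  assumes "\<eta> \<in> Lambda_can A \<phi> k" "\<zeta> \<in> Lambda_can A \<phi> k" "1 \<le> k"
  shows "\<eta> - \<zeta> \<in> Lambda_can A \<phi> k"
proof -
  consider "k = 1" "\<eta> \<in> Omega A 1" "\<zeta> \<in> Omega A 1"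
    | X Y where "k = 2" "X \<in> VF" "\<eta> = (\<lambda>vs. \<phi> (X # vs))" "Y \<in> VF" "\<zeta> = (\<lambda>vs. \<phi> (Y # vs))"
    | f h where "k = 3" "f \<in> C" "\<eta> = act f \<phi>" "h \<in> C" "\<zeta> = act h \<phi>" | "3 < k" "\<eta> = 0" "\<zeta> = 0"
    using assms by (auto simp: Lambda_can_def split: if_splits)
  then show ?thesis
  proof cases
    case 1
    then have "\<eta> - \<zeta> \<in> Omega A 1" using Omega_1_iff multilinear_diff by auto
    then show ?thesis using 1 by (simp add: Lambda_can_def)
  next
    case 2
    have "\<eta> - \<zeta> = (\<lambda>vs. \<phi> ((X - Y) # vs))"
    proof
      fix vs
      show "(\<eta> - \<zeta>) vs = \<phi> ((X - Y) # vs)"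
      proof (cases "vs \<in> args A 2")
        case True
        have "\<phi> (X # vs) = \<phi> ((X - Y) # vs) + \<phi> (Y # vs)"
          using tensorialD(2)[OF phi_tensorial[OF True], of "X - Y" Y] 2 by simp
        then show ?thesis using 2 by simp
      next
        case False
        then have "W # vs \<notin> args A 3" for W by (simp add: numeral_3_eq_3 numeral_2_eq_2)
        then show ?thesis using 2 by (simp add: phi_outside)
      qed
    qed
    then show ?thesis using 2 by (auto simp: Lambda_can_def)
  next
    case 3
    then have "\<eta> - \<zeta> = act (f - h) \<phi>" by (simp add: act_def fun_eq_iff left_diff_distrib)
    then show ?thesis using 3 by (auto simp: Lambda_can_def)
  qed (simp add: Lambda_can_def)
qed

definition is_projection :: "nat \<Rightarrow> 'a form \<Rightarrow> 'a form \<Rightarrow> bool" where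
  "is_projection k u \<eta> \<longleftrightarrow>
     \<eta> \<in> Lambda_can A \<phi> k \<and> (\<forall>\<zeta>\<in>Lambda_can A \<phi> k. form_inner A g k (u - \<eta>) \<zeta> = 0)"

text \<open>The difference of two projections lies in the subbundle and is orthogonal to it.\<close>

lemma is_projection_unique:
  assumes "is_projection k u \<eta>" "is_projection k u \<zeta>" "1 \<le> k"
  shows "\<eta> = \<zeta>"
proof -
  have d: "\<eta> - \<zeta> \<in> Lambda_can A \<phi> k"
    using assms by (auto simp: is_projection_def intro: Lambda_can_diff)
  have "form_inner A g k (\<eta> - \<zeta>) (\<eta> - \<zeta>)
      = form_inner A g k (u - \<zeta>) (\<eta> - \<zeta>) - form_inner A g k (u - \<eta>) (\<eta> - \<zeta>)"
    by (simp add: form_inner_diff)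
  also have "\<dots> = 0" using assms d by (simp add: is_projection_def)
  finally have "\<eta> - \<zeta> = 0"
    using Lambda_can_multilinear[OF d assms(3)] by (intro form_inner_definite) auto
  then show ?thesis by simp
qed

lemma proj_form_eqI:
  assumes "is_projection k u \<eta>" "1 \<le> k" shows "proj_form A \<phi> g k u = \<eta>"
  unfolding proj_form_def is_projection_def[symmetric]
  using assms is_projection_unique by blast

text \<open>Existence matters even for the sign rule: a definite description that nothing satisfies denotes
  the same unspecified form for \<open>u\<close> and for \<open>- u\<close>.  Degree 1 is the identity, degrees above 3 are
  zero, and in degrees 2 and 3 the norms computed above are the normalizing constants.\<close>

lemma is_projection_exists:
  assumes u: "multilinear k u" "\<And>vs. vs \<notin> args A k \<Longrightarrow> u vs = 0" and k: "1 \<le> k"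
  shows "\<exists>\<eta>. is_projection k u \<eta>"
proof -
  consider "k = 1" | "k = 2" | "k = 3" | "3 < k" using k by linarith
  then show ?thesis
  proof cases
    case 1
    then have "is_projection k u u"
      using u Omega_1_iff by (auto simp: is_projection_def Lambda_can_def form_inner_def Let_def fun_eq_iff)
    then show ?thesis by blast
  next
    case 2
    obtain V where V: "V \<in> VF" "\<And>Y. Y \<in> VF \<Longrightarrow> g Y V = form_inner A g 2 u (\<lambda>vs. \<phi> (Y # vs))"
      using sharp_exists[OF inner_iota_tensorial] u(1) 2 by blast
    let ?X = "act (\<lambda>_. 1 / 3) V"
    have X: "?X \<in> VF" using V(1) by simp
    have "form_inner A g 2 (u - (\<lambda>vs. \<phi> (?X # vs))) (\<lambda>vs. \<phi> (Y # vs)) = 0" if Y: "Y \<in> VF" for Y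
    proof
      fix p
      show "form_inner A g 2 (u - (\<lambda>vs. \<phi> (?X # vs))) (\<lambda>vs. \<phi> (Y # vs)) p = 0 p"
        using inner_iota_phi[OF X Y] V metric_act(2)[OF V(1) Y const_smooth[of "1 / 3"]]
          metric_sym[OF V(1) Y] Y
        by (simp add: form_inner_diff)
    qed
    then have "is_projection k u (\<lambda>vs. \<phi> (?X # vs))"
      using 2 X by (auto simp: is_projection_def Lambda_can_def)
    then show ?thesis by blast
  next
    case 3
    define f where "f = (\<lambda>x. 1 / 7 * form_inner A g 3 u \<phi> x)"
    have f: "f \<in> C"
      unfolding f_def using u(1) 3 by (intro scale_smooth form_inner_smooth phi_multilinear) simp_all
    have "form_inner A g 3 (u - act f \<phi>) (act h \<phi>) = 0" for h
    proof
      fix p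
      have "form_inner A g 3 v (act h \<phi>) p = h p * form_inner A g 3 v \<phi> p"
        "form_inner A g 3 (act h \<phi>) v p = h p * form_inner A g 3 \<phi> v p" for v h
        by (simp_all add: form_inner_def Let_def sum_distrib_left mult_ac)
      then show "form_inner A g 3 (u - act f \<phi>) (act h \<phi>) p = 0 p"
        by (simp add: form_inner_diff inner_phi_phi f_def)
    qed
    then have "is_projection k u (act f \<phi>)"
      using 3 f by (auto simp: is_projection_def Lambda_can_def)
    then show ?thesis by blast
  next
    case 4
    then have "is_projection k u 0"
      by (simp add: is_projection_def Lambda_can_def form_inner_def Let_def fun_eq_iff)
    then show ?thesis by blast
  qed
qed

lemma proj_form_uminus:
  assumes u: "multilinear k u" "\<And>vs. vs \<notin> args A k \<Longrightarrow> u vs = 0" and k: "1 \<le> k"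
  shows "proj_form A \<phi> g k (- u) = - proj_form A \<phi> g k u"
proof -
  obtain \<eta> where \<eta>: "is_projection k u \<eta>" using is_projection_exists[OF u k] by blast
  have L: "\<eta> \<in> Lambda_can A \<phi> k" using \<eta> by (simp add: is_projection_def)
  have "(\<eta> - \<eta>) - \<eta> \<in> Lambda_can A \<phi> k" by (intro Lambda_can_diff L k)
  then have "- \<eta> \<in> Lambda_can A \<phi> k" by simp
  moreover have "form_inner A g k (- u - - \<eta>) \<zeta> = 0" if "\<zeta> \<in> Lambda_can A \<phi> k" for \<zeta>
  proof -
    have "- u - - \<eta> = - (u - \<eta>)" by simp
    then show ?thesis using \<eta> that by (simp only: form_inner_uminus) (simp add: is_projection_def)
  qed
  ultimately have "is_projection k (- u) (- \<eta>)" by (simp add: is_projection_def)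
  then show ?thesis using proj_form_eqI \<eta> k by simp
qed

lemma proj_cov_uminus:
  assumes "\<And>Z. multilinear k (\<lambda>vs. M vs Z)" "\<And>vs Z. vs \<notin> args A k \<Longrightarrow> M vs Z = 0" "1 \<le> k"
  shows "proj_cov A \<phi> g k M + proj_cov A \<phi> g k (- M) = 0"
proof (intro ext)
  fix vs Z p
  have "proj_form A \<phi> g k (- (\<lambda>us. M us Z)) = - proj_form A \<phi> g k (\<lambda>us. M us Z)"
    using assms by (intro proj_form_uminus)
  moreover have "(\<lambda>us. (- M) us Z) = - (\<lambda>us. M us Z)" by (simp add: fun_eq_iff)
  ultimately show "(proj_cov A \<phi> g k M + proj_cov A \<phi> g k (- M)) vs Z p = 0 vs Z p"
    by (simp add: proj_cov_def)
qed

end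

section \<open>The residual coupling\<close>

text \<open>In the pairs standing for \<open>u + \<epsilon> v\<close> the first components are zero forms.  Their projections
  are again given by a description, so they are treated like the second components.\<close>

theorem proposition6p1:
  fixes A :: "'a::{t2_space,second_countable_topology} chart set"
    and \<phi> vol :: "'a form" and g :: "'a metric" and D :: "'a connection"
  assumes "smooth_atlas A"
    and "G2_structure A \<phi> g vol"
    and "torsion_free A \<phi> g vol"
    and "levi_civita A g D"
  shows "(\<forall>k\<in>{0..3}. \<forall>m\<in>G0 A \<phi> k. can_c A \<phi> g D k m + can_b A \<phi> g D k (op_K A g D k m) = 0) \<and>
         (\<forall>p. \<forall>m\<in>Omega_cov A p. op_c A g D p m + op_b A D p (op_K A g D p m) = 0)"
proof -
  have loc: "\<exists>U E. open U \<and> p \<in> U \<and> (\<forall>x\<in>U. on_frame_at A g x E \<and>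
      (\<forall>vs\<in>args A 3. \<phi> vs x = phi_std (\<lambda>i. g (E i)) vs x))" for p
    using assms(2) unfolding G2_structure_def by meson
  interpret L: levi_civita_manifold A g D
  proof
    show "smooth_atlas A" "levi_civita A g D" by fact+
    show "riemannian_metric A g" using assms(2) by (simp add: G2_structure_def)
    show "\<exists>U E. open U \<and> p \<in> U \<and> (\<forall>x\<in>U. on_frame_at A g x E)" for p
      using loc[of p] by meson
  qed
  interpret G: G2_manifold A g \<phi>
  proof
    show "\<phi> \<in> Omega A 3" using assms(2) by (simp add: G2_structure_def)
    show "\<exists>E. on_frame_at A g p E \<and> (\<forall>vs\<in>args A 3. \<phi> vs p = phi_std (\<lambda>i. g (E i)) vs p)" for p
      using loc[of p] by meson
  qed
  have cancel: "op_c A g D p m = (0, M)" "op_b A D p (op_K A g D p m) = (0, - M)"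
    if "m \<in> Omega_cov A p" "M = curv_pairing A D (- 1 / 2) p (op_B A g D p m)" for p m M
    using L.curv_pairing_K[OF that(1)] that(2) by (simp_all add: op_c_def op_b_def eps_def)
  show ?thesis
  proof (intro conjI ballI allI)
    fix p m assume "m \<in> Omega_cov A p"
    then show "op_c A g D p m + op_b A D p (op_K A g D p m) = 0"
      by (simp add: cancel zero_prod_def)
  next
    fix k m assume "m \<in> G0 A \<phi> k"
    then have m: "m \<in> Omega_cov A k" by (simp add: G0_def)
    let ?M = "curv_pairing A D (- 1 / 2) k (op_B A g D k m)"
    have "proj_cov A \<phi> g (k + 1) ?M + proj_cov A \<phi> g (k + 1) (- ?M) = 0"
      by (rule G.proj_cov_uminus)
         (use L.curv_pairing_multilinear[OF L.op_B_spec(1)[OF m]] L.curv_pairing_outside in auto)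
    moreover have "proj_cov A \<phi> g (k + 1) 0 + proj_cov A \<phi> g (k + 1) (- 0) = 0"
      by (rule G.proj_cov_uminus) (auto simp: L.multilinear_def L.tensorial_const_zero)
    ultimately show "can_c A \<phi> g D k m + can_b A \<phi> g D k (op_K A g D k m) = 0"
      by (simp add: can_c_def can_b_def cancel[OF m refl] zero_prod_def)
  qed
qed

end
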